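(* Let $G=I_2(N)$ with constant multiplicity $m\in\mathbb Z_{\ge0}$. The ring $Q_m$ is a free finitely generated module over its subring $S^G\subset Q_m$ of invariant polynomials. One can choose the polynomials $$q_0,\ q_1,\ldots,q_{N-1},\ \bar q_1,\ldots,\bar q_{N-1},\ q_N$$ as a basis of $Q_m$ over $S^G$.
   Context: $G=I_2(N)$, $N\ge2$, is the dihedral group of order $2N$ acting on the Euclidean plane with coordinates $(x_1,x_2)$, generated by the reflections in the lines $(\alpha^j,x)=0$, $\alpha^j=(-\sin\frac{\pi j}{N},\cos\frac{\pi j}{N})$, $j=0,\ldots,N-1$. All multiplicities equal $m\in\mathbb Z_{\ge0}$. Put $z=x_1+ix_2$, $\bar z=x_1-ix_2$. Polynomials have complex coefficients. The ring $S^G$ of $G$-invariant polynomials is freely generated by $\sigma_1=z\bar z$, $\sigma_2=z^N+\bar z^N$. $Q_m$ is the ring of $m$-quasiinvariants: polynomials $q(x_1,x_2)$ such that for each $\alpha=\alpha^j$ the derivatives $\partial_\alpha^{s}q$, $s=1,3,\ldots,2m-1$, vanish on the line $(\alpha,x)=0$, where $\partial_\alpha=(\alpha,\partial/\partial x)$. For $j=1,\ldots,N-1$, $$q_j=\sum_{t=0}^m a_{jt}\,\bar z^{tN}z^{(m-t)N+j},\qquad \bar q_j=\sum_{t=0}^m \bar a_{jt}\,z^{tN}\bar z^{(m-t)N+j},$$ where $(a_{j0},\ldots,a_{jm})$ is a nonzero solution (unique up to proportionality) of the linear system $\sum_{t=0}^m\big((m-2t)N+j\big)^{2s-1}a_{jt}=0$,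 $s=1,\ldots,m$, and $\bar a_{jt}$ is the complex conjugate of $a_{jt}$. Also $q_0=1$ and $q_N=(z^N-\bar z^N)^{2m+1}$. *)

theory Defs
  imports
    "HOL-Analysis.Analysis"
    "HOL-Computational_Algebra.Polynomial"
    "HOL-Algebra.Bij"
    "HOL-Algebra.Generated_Groups"
begin

section \<open>Polynomials in two variables on the Euclidean plane\<close>

text \<open>
  The ring of complex polynomials in $x_1, x_2$ is \<open>\<complex>[x\<^sub>1][x\<^sub>2]\<close>: the inner
  polynomial variable is $x_1$, the outer one is $x_2$.
\<close>

type_synonym bipoly = "complex poly poly"

definition Const :: "complex \<Rightarrow> bipoly" where
  "Const c = [:[:c:]:]"

definition X1 :: bipoly where
  "X1 = [:[:0, 1:]:]"

definition X2 :: bipoly where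
  "X2 = [:0, 1:]"

definition Z :: bipoly where
  "Z = X1 + Const \<i> * X2"

definition Zbar :: bipoly where
  "Zbar = X1 - Const \<i> * X2"

definition eval2 :: "bipoly \<Rightarrow> real ^ 2 \<Rightarrow> complex" where
  "eval2 p x = poly (poly p [:of_real (x $ 2):]) (of_real (x $ 1))"

definition dir_deriv :: "real ^ 2 \<Rightarrow> bipoly \<Rightarrow> bipoly" where
  "dir_deriv v p =
     Const (of_real (v $ 1)) * map_poly pderiv p + Const (of_real (v $ 2)) * pderiv p"


section \<open>The dihedral group, its invariants and its quasiinvariants\<close>

definition root_vec :: "nat \<Rightarrow> nat \<Rightarrow> real ^ 2" where
  "root_vec N j = vector [- sin (pi * real j / real N), cos (pi * real j / real N)]"

definition reflection :: "real ^ 2 \<Rightarrow> real ^ 2 \<Rightarrow> real ^ 2" where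
  "reflection v x = x - (2 * (v \<bullet> x) / (v \<bullet> v)) *\<^sub>R v"

definition dihedral :: "nat \<Rightarrow> (real ^ 2 \<Rightarrow> real ^ 2) set" where
  "dihedral N = generate (BijGroup UNIV) ((\<lambda>j. reflection (root_vec N j)) ` {..<N})"

text \<open>
  A polynomial is determined by its values on the real plane, so invariance
  can be expressed through evaluation.
\<close>

definition invariants :: "nat \<Rightarrow> bipoly set" where
  "invariants N = {p. \<forall>g\<in>dihedral N. \<forall>x. eval2 p (g x) = eval2 p x}"

definition quasiinvariants :: "nat \<Rightarrow> nat \<Rightarrow> bipoly set" where
  "quasiinvariants N m =
     {q. \<forall>j<N. \<forall>s. odd s \<and> s < 2 * m \<longrightarrow>
           (\<forall>x. root_vec N j \<bullet> x = 0 \<longrightarrow>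
             eval2 ((dir_deriv (root_vec N j) ^^ s) q) x = 0)}"


section \<open>Subrings and bases of modules over a subring\<close>

definition is_subring :: "'a::comm_ring_1 set \<Rightarrow> bool" where
  "is_subring R \<longleftrightarrow>
     0 \<in> R \<and> 1 \<in> R \<and> (\<forall>x\<in>R. \<forall>y\<in>R. x + y \<in> R) \<and> (\<forall>x\<in>R. - x \<in> R) \<and>
     (\<forall>x\<in>R. \<forall>y\<in>R. x * y \<in> R)"

text \<open>
  A finite family (given as a list, so that repetitions would violate linear
  independence) that lies in \<open>M\<close>, spans \<open>M\<close> over \<open>R\<close> and is linearly
  independent over \<open>R\<close>.
\<close>

definition is_basis :: "'a::comm_ring_1 set \<Rightarrow> 'a set \<Rightarrow> 'a list \<Rightarrow> bool" where
  "is_basis R M bs \<longleftrightarrow>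
     set bs \<subseteq> M \<and>
     (\<forall>x\<in>M. \<exists>c. (\<forall>i<length bs. c i \<in> R) \<and> x = (\<Sum>i<length bs. c i * bs ! i)) \<and>
     (\<forall>c. (\<forall>i<length bs. c i \<in> R) \<and> (\<Sum>i<length bs. c i * bs ! i) = 0 \<longrightarrow>
          (\<forall>i<length bs. c i = 0))"

definition free_fin_gen :: "'a::comm_ring_1 set \<Rightarrow> 'a set \<Rightarrow> bool" where
  "free_fin_gen R M \<longleftrightarrow> (\<exists>bs. is_basis R M bs)"


section \<open>The explicit quasiinvariants\<close>

definition coeff_solution :: "nat \<Rightarrow> nat \<Rightarrow> nat \<Rightarrow> (nat \<Rightarrow> complex) \<Rightarrow> bool" where
  "coeff_solution N m j a \<longleftrightarrow>
     (\<exists>t\<le>m. a t \<noteq> 0) \<and>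
     (\<forall>s\<in>{1..m}.
        (\<Sum>t\<le>m. of_int (((int m - 2 * int t) * int N + int j) ^ (2 * s - 1)) * a t) = 0)"

definition q_poly :: "nat \<Rightarrow> nat \<Rightarrow> nat \<Rightarrow> (nat \<Rightarrow> complex) \<Rightarrow> bipoly" where
  "q_poly N m j a = (\<Sum>t\<le>m. Const (a t) * Zbar ^ (t * N) * Z ^ ((m - t) * N + j))"

definition qbar_poly :: "nat \<Rightarrow> nat \<Rightarrow> nat \<Rightarrow> (nat \<Rightarrow> complex) \<Rightarrow> bipoly" where
  "qbar_poly N m j a = (\<Sum>t\<le>m. Const (cnj (a t)) * Z ^ (t * N) * Zbar ^ ((m - t) * N + j))"

definition q_last :: "nat \<Rightarrow> nat \<Rightarrow> bipoly" where
  "q_last N m = (Z ^ N - Zbar ^ N) ^ (2 * m + 1)"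

definition q_family :: "nat \<Rightarrow> nat \<Rightarrow> (nat \<Rightarrow> nat \<Rightarrow> complex) \<Rightarrow> bipoly list" where
  "q_family N m a =
     [1] @ map (\<lambda>j. q_poly N m j (a j)) [1..<N] @
     map (\<lambda>j. qbar_poly N m j (a j)) [1..<N] @ [q_last N m]"

end

theory Submission
  imports Defs
begin

text \<open>
  On a mirror, the vanishing of the odd normal derivatives of order below $2m$ is equivalent to the
  vanishing of the odd angular derivatives, because the angular derivative is
  \<open>t \<partial>\<^sub>n - n \<partial>\<^sub>t\<close> in coordinates \<open>(n, t)\<close> normal and tangent to the mirror and hence flips
  the parity in the normal direction. As \<open>z\<^sup>a zbar\<^sup>b\<close> is an eigenvector of the angular derivative, a
  discrete Fourier transform over the mirrors turns quasiinvariance into linear equations on the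
  coefficients $c_a$ of $z^a \bar z^{d-a}$: for every residue class modulo $N$ and every odd
  \<open>s < 2m\<close>, the sum of $(2a-d)^s c_a$ over the exponents \<open>a\<close> in that class vanishes. These are
  Vandermonde systems.

  Spanning: by the Vandermonde systems the coefficients of $z^d$ and $\bar z^d$ of a homogeneous
  quasiinvariant can be matched by a combination of \<open>\<sigma>\<^sub>2\<close>-power multiples of the proposed generators.
  The difference is divisible by \<open>\<sigma>\<^sub>1\<close>, the quotient is again a quasiinvariant, and
  one descends on \<open>d\<close>.

  Independence: reduce a relation modulo $\bar z$ and modulo $z$. An invariant reduces to a
  polynomial in $z^N$, respectively the same polynomial in $\bar z^N$, so comparing residues of
  exponents modulo $N$ shows that all coefficients of the relation vanish modulo \<open>\<sigma>\<^sub>1\<close>; divide by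
  \<open>\<sigma>\<^sub>1\<close> and descend on the degree.
\<close>

section \<open>Polynomials in Z and Zbar, and their derivations\<close>

locale ring_map =
  fixes h :: "'a::comm_ring_1 \<Rightarrow> 'b::comm_ring_1"
  assumes add: "h (x + y) = h x + h y"
    and mult: "h (x * y) = h x * h y"
    and one: "h 1 = 1"
begin

lemma zero: "h 0 = 0"
  using add[of 0 0] by simp

lemma minus: "h (- x) = - h x"
  using add[of x "- x"] zero by (simp add: eq_neg_iff_add_eq_0 add.commute)

lemma diff: "h (x - y) = h x - h y"
  using add[of x "- y"] minus by simp

lemma sum: "h (sum f A) = (\<Sum>x\<in>A. h (f x))"
  by (induction A rule: infinite_finite_induct) (auto simp: zero add)

lemma power: "h (x ^ n) = h x ^ n"
  by (induction n) (auto simp: one mult)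

lemmas hom_simps = zero one add minus diff mult power sum

end

definition lift_map :: "('a::comm_ring_1 \<Rightarrow> 'b::comm_ring_1) \<Rightarrow> 'b \<Rightarrow> 'a poly \<Rightarrow> 'b" where
  "lift_map f b p = poly (map_poly f p) b"

lemma lift_map_pCons: "ring_map f \<Longrightarrow> lift_map f b (pCons a p) = f a + b * lift_map f b p"
  by (simp add: lift_map_def map_poly_pCons ring_map.zero)

lemma lift_map_0: "lift_map f b 0 = 0"
  by (simp add: lift_map_def)

lemma ring_map_lift_map:
  assumes f: "ring_map f"
  shows "ring_map (lift_map f b)"
proof -
  note s = lift_map_pCons[OF f] lift_map_0 ring_map.hom_simps[OF f]
  have add: "lift_map f b (p + q) = lift_map f b p + lift_map f b q" for p q
    by (induction p q rule: poly_induct2) (auto simp: s algebra_simps)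
  have smult: "lift_map f b (smult c q) = f c * lift_map f b q" for c q
    by (induction q) (auto simp: s algebra_simps)
  have mult: "lift_map f b (p * q) = lift_map f b p * lift_map f b q" for p q
    by (induction p) (auto simp: s add smult algebra_simps)
  show ?thesis
    by unfold_locales (auto simp: add mult s one_pCons)
qed

text \<open>The universal property of the polynomial ring: restriction to a mirror, the action of a
  reflection and the reductions modulo \<open>Zbar\<close> and \<open>Z\<close> are all instances,
  with different images of the two variables.\<close>

definition subst2 :: "(complex \<Rightarrow> 'b::comm_ring_1) \<Rightarrow> 'b \<Rightarrow> 'b \<Rightarrow> bipoly \<Rightarrow> 'b" where
  "subst2 f x y = lift_map (lift_map f x) y"

lemma ring_map_subst2: "ring_map f \<Longrightarrow> ring_map (subst2 f x y)"
  unfolding subst2_def by (intro ring_map_lift_map)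

lemma subst2_simps:
  assumes "ring_map f"
  shows "subst2 f x y (Const c) = f c" "subst2 f x y X1 = x" "subst2 f x y X2 = y"
  using assms ring_map_lift_map[OF assms, of x]
  by (simp_all add: subst2_def Const_def X1_def X2_def lift_map_pCons lift_map_0
      ring_map.zero ring_map.one)

lemma bipoly_induct [case_names Const add X1 X2]:
  assumes C: "\<And>c. P (Const c)" and add: "\<And>p q. P p \<Longrightarrow> P q \<Longrightarrow> P (p + q)"
    and X1: "\<And>p. P p \<Longrightarrow> P (X1 * p)" and X2: "\<And>p. P p \<Longrightarrow> P (X2 * p)"
  shows "P p"
proof (induction p)
  case 0
  then show ?case using C[of 0] by (simp add: Const_def)
next
  case (pCons a p)
  have "P [:a:]"
  proof (induction a)
    case 0
    then show ?case using C[of 0] by (simp add: Const_def)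
  next
    case (pCons c r)
    have "[:pCons c r:] = Const c + X1 * [:r:]" by (simp add: Const_def X1_def)
    then show ?case using pCons C add X1 by metis
  qed
  moreover have "pCons a p = [:a:] + X2 * p" by (simp add: X2_def)
  ultimately show ?case using pCons add X2 by metis
qed

interpretation Const: ring_map Const
  by unfold_locales (auto simp: Const_def one_pCons)

lemma X1_Z: "X1 = Const (1/2) * Z + Const (1/2) * Zbar"
  and X2_Z: "X2 = Const (- \<i> / 2) * Z + Const (\<i> / 2) * Zbar"
  by (simp_all add: X1_def X2_def Z_def Zbar_def Const_def)

lemma zz_induct [case_names mono add]:
  assumes m: "\<And>c a b. P (Const c * Z ^ a * Zbar ^ b)"
    and add: "\<And>p q. P p \<Longrightarrow> P q \<Longrightarrow> P (p + q)"
  shows "P p"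
proof -
  \<comment> \<open>The claim is strengthened by a monomial factor, which absorbs the
    \<open>Z\<close> and \<open>Zbar\<close> that each variable contributes.\<close>
  have "P (Const c * Z ^ a * Zbar ^ b * p)" for a b c
  proof (induction p arbitrary: a b c rule: bipoly_induct)
    case (Const c')
    have "Const c * Z ^ a * Zbar ^ b * Const c' = Const (c * c') * Z ^ a * Zbar ^ b"
      unfolding Const.mult by (simp only: mult_ac)
    then show ?case using m by metis
  next
    case (add p q)
    then show ?case using assms(2) by (simp add: distrib_left)
  next
    case (X1 p)
    have "Const c * Z ^ a * Zbar ^ b * (X1 * p) = Const (c * (1/2)) * Z ^ Suc a * Zbar ^ b * p
       + Const (c * (1/2)) * Z ^ a * Zbar ^ Suc b * p"
      unfolding X1_Z Const.mult power_Suc by (simp add: algebra_simps)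
    then show ?case using X1 assms(2) by metis
  next
    case (X2 p)
    have "Const c * Z ^ a * Zbar ^ b * (X2 * p) = Const (c * (- \<i> / 2)) * Z ^ Suc a * Zbar ^ b * p
       + Const (c * (\<i> / 2)) * Z ^ a * Zbar ^ Suc b * p"
      unfolding X2_Z Const.mult power_Suc by (simp add: algebra_simps)
    then show ?case using X2 assms(2) by metis
  qed
  from this[of 1 0 0] show ?thesis by (simp add: Const.one)
qed

interpretation eval2: ring_map "\<lambda>p. eval2 p x" for x
  by unfold_locales (auto simp: eval2_def)

lemma eval2_simps [simp]: "eval2 (Const c) x = c" "eval2 X1 x = of_real (x $ 1)" "eval2 X2 x = of_real (x $ 2)"
  by (auto simp: eval2_def Const_def X1_def X2_def)

lemma poly_eq_0_if_real:
  fixes p :: "complex poly"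
  assumes "\<And>r::real. poly p (of_real r) = 0"
  shows "p = 0"
proof (rule ccontr)
  assume "p \<noteq> 0"
  then have "finite {x. poly p x = 0}" by (rule poly_roots_finite)
  moreover have "range (of_real :: real \<Rightarrow> complex) \<subseteq> {x. poly p x = 0}" using assms by auto
  ultimately have "finite (range (of_real :: real \<Rightarrow> complex))" by (rule rev_finite_subset)
  then have "finite (UNIV :: real set)" by (rule finite_imageD) (simp add: inj_def)
  then show False using infinite_UNIV_char_0 by blast
qed

text \<open>For a fixed real second coordinate the difference has infinitely many roots in the first
  one; hence the outer polynomial has infinitely many constant roots.\<close>

lemma eval2_eqI:
  assumes "\<And>x. eval2 p x = eval2 q x"
  shows "p = q"
proof -
  have *: "poly (p - q) [:of_real s:] = 0" for s :: real
  proof (rule poly_eq_0_if_real)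
    fix r :: real
    show "poly (poly (p - q) [:complex_of_real s:]) (complex_of_real r) = 0"
      using assms[of "vector [r, s]"] by (simp add: eval2_def)
  qed
  have "p - q = 0"
  proof (rule ccontr)
    assume "p - q \<noteq> 0"
    then have "finite {x. poly (p - q) x = 0}" by (rule poly_roots_finite)
    moreover have "range (\<lambda>s::real. [:complex_of_real s:]) \<subseteq> {x. poly (p - q) x = 0}" using * by blast
    ultimately have "finite (range (\<lambda>s::real. [:complex_of_real s:]))" by (rule rev_finite_subset)
    then have "finite (UNIV :: real set)" by (rule finite_imageD) (simp add: inj_def)
    then show False using infinite_UNIV_char_0 by blast
  qed
  then show ?thesis by simp
qed

section \<open>Directional derivatives and the angular derivative\<close>

lemma map_poly_pderiv_add:
  fixes p q :: "'a::idom poly poly"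
  shows "map_poly pderiv (p + q) = map_poly pderiv p + map_poly pderiv q"
  by (intro poly_eqI) (simp add: coeff_map_poly pderiv_add)

lemma pderiv_sum: "pderiv (sum f A) = (\<Sum>x\<in>A. pderiv (f x))"
  by (induction A rule: infinite_finite_induct) (auto simp: pderiv_add)

lemma map_poly_pderiv_mult:
  fixes p q :: "'a::idom poly poly"
  shows "map_poly pderiv (p * q) = map_poly pderiv p * q + p * map_poly pderiv q"
  by (rule poly_eqI)
    (simp add: coeff_map_poly pderiv_mult coeff_mult pderiv_sum flip: sum.distrib,
      simp add: add.commute mult.commute)

lemma pderiv_map_poly_pderiv:
  fixes p :: "'a::idom poly poly"
  shows "pderiv (map_poly pderiv p) = map_poly pderiv (pderiv p)"
  by (intro poly_eqI) (simp add: coeff_map_poly coeff_pderiv pderiv_mult pderiv_add pderiv_of_nat)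

lemma pderiv_Const: "pderiv (Const c) = 0" "map_poly pderiv (Const c) = 0"
  and pderiv_X: "pderiv X1 = 0" "pderiv X2 = 1" "map_poly pderiv X1 = 1" "map_poly pderiv X2 = 0"
  by (auto simp: Const_def X1_def X2_def map_poly_pCons pderiv_pCons one_pCons)

lemma dir_deriv_add: "dir_deriv v (p + q) = dir_deriv v p + dir_deriv v q"
  by (simp add: dir_deriv_def map_poly_pderiv_add pderiv_add algebra_simps)

lemma dir_deriv_mult: "dir_deriv v (p * q) = dir_deriv v p * q + p * dir_deriv v q"
  by (simp add: dir_deriv_def map_poly_pderiv_mult pderiv_mult algebra_simps)

lemma dir_deriv_Const: "dir_deriv v (Const c) = 0"
  and dir_deriv_X1: "dir_deriv v X1 = Const (of_real (v $ 1))"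
  and dir_deriv_X2: "dir_deriv v X2 = Const (of_real (v $ 2))"
  by (auto simp: dir_deriv_def pderiv_Const pderiv_X)

lemma dir_deriv_commute: "dir_deriv v (dir_deriv w p) = dir_deriv w (dir_deriv v p)"
  by (simp add: dir_deriv_def map_poly_pderiv_add pderiv_add map_poly_pderiv_mult pderiv_mult
      pderiv_Const pderiv_map_poly_pderiv algebra_simps)

text \<open>The linear form vanishing on the mirror of \<open>v\<close>. For a unit vector,
  \<open>lin v\<close> and \<open>lin (perp v)\<close> are the normal and tangential
  coordinates.\<close>

definition lin :: "real ^ 2 \<Rightarrow> bipoly" where
  "lin v = Const (of_real (v $ 1)) * X1 + Const (of_real (v $ 2)) * X2"

definition perp :: "real ^ 2 \<Rightarrow> real ^ 2" where
  "perp v = vector [v $ 2, - v $ 1]"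

lemma perp_simps [simp]: "perp v $ 1 = v $ 2" "perp v $ 2 = - v $ 1"
  by (simp_all add: perp_def)

text \<open>The angular derivative, that is, the derivative with respect to the polar angle.\<close>

definition rotd :: "bipoly \<Rightarrow> bipoly" where
  "rotd p = X1 * pderiv p - X2 * map_poly pderiv p"

lemma rotd_add: "rotd (p + q) = rotd p + rotd q"
  by (simp add: rotd_def map_poly_pderiv_add pderiv_add algebra_simps)

lemma rotd_mult: "rotd (p * q) = rotd p * q + p * rotd q"
  by (simp add: rotd_def map_poly_pderiv_mult pderiv_mult algebra_simps)

lemma rotd_Const: "rotd (Const c) = 0"
  by (simp add: rotd_def pderiv_Const)

lemma rotd_X1: "rotd X1 = - X2" and rotd_X2: "rotd X2 = X1"
  by (simp_all add: rotd_def pderiv_X)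

lemma rotd_Z: "rotd Z = Const \<i> * Z" and rotd_Zbar: "rotd Zbar = Const (- \<i>) * Zbar"
proof -
  have *: "Const \<i> * Const \<i> = -1" by (simp flip: Const.mult add: Const.minus Const.one)
  have "Const \<i> * (Const \<i> * X2) = - X2" by (simp add: * flip: mult.assoc)
  then show "rotd Z = Const \<i> * Z"
    by (simp add: Z_def rotd_add rotd_mult rotd_X1 rotd_X2 rotd_Const distrib_left)
  have "rotd (X1 + Const (- \<i>) * X2) = - X2 + Const (- \<i>) * X1"
    unfolding rotd_add rotd_mult rotd_X1 rotd_X2 rotd_Const by simp
  moreover have "Zbar = X1 + Const (- \<i>) * X2" by (simp add: Zbar_def Const.minus)
  ultimately have "rotd Zbar = - X2 + Const (- \<i>) * X1" by simp
  with \<open>Const \<i> * (Const \<i> * X2) = - X2\<close> show "rotd Zbar = Const (- \<i>) * Zbar"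
    by (simp add: Zbar_def Const.minus right_diff_distrib)
qed

lemma rotd_power:
  assumes "rotd p = Const c * p"
  shows "rotd (p ^ n) = Const (of_nat n * c) * p ^ n"
  by (induction n) (auto simp: rotd_mult assms Const.add Const.mult algebra_simps Const.zero
    rotd_Const[of 1, unfolded Const.one])

lemma rotd_mono: "rotd (Const c * Z ^ a * Zbar ^ b) = Const (c * (\<i> * (of_nat a - of_nat b))) * Z ^ a * Zbar ^ b"
  by (simp add: rotd_mult rotd_Const rotd_power[OF rotd_Z] rotd_power[OF rotd_Zbar]
    Const.mult Const.add Const.diff Const.minus algebra_simps)

lemma rotd_pow_add: "(rotd ^^ s) (p + q) = (rotd ^^ s) p + (rotd ^^ s) q"
  by (induction s) (auto simp: rotd_add)

lemma rotd_pow_0: "(rotd ^^ s) 0 = 0"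
  using rotd_pow_add[of s 0 0] by simp

lemma rotd_pow_sum: "(rotd ^^ s) (sum f A) = (\<Sum>x\<in>A. (rotd ^^ s) (f x))"
  by (induction A rule: infinite_finite_induct) (auto simp: rotd_pow_0 rotd_pow_add)

lemma rotd_pow_mono:
  "(rotd ^^ s) (Const c * Z ^ a * Zbar ^ b) =
    Const (c * (\<i> * (of_nat a - of_nat b)) ^ s) * Z ^ a * Zbar ^ b"
proof (induction s)
  case (Suc s)
  then show ?case by (simp only: funpow.simps comp_def rotd_mono) (simp add: mult_ac)
qed simp

text \<open>Expanding the right-hand side produces the angular derivative times the squared length
  of \<open>v\<close>. This is the formula in coordinates adapted to the mirror.\<close>

lemma rotd_split:
  assumes "(v $ 1)\<^sup>2 + (v $ 2)\<^sup>2 = 1"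
  shows "rotd p = lin (perp v) * dir_deriv v p - lin v * dir_deriv (perp v) p"
proof -
  define a b where "a = Const (of_real (v $ 1))" and "b = Const (of_real (v $ 2))"
  have 1: "a * a + b * b = 1"
    unfolding a_def b_def using assms
    by (simp flip: Const.mult Const.add of_real_mult of_real_add add: power2_eq_square Const.one)
  have "lin (perp v) * dir_deriv v p - lin v * dir_deriv (perp v) p =
      (a * a + b * b) * rotd p"
    by (simp add: lin_def dir_deriv_def rotd_def Const.minus flip: a_def b_def) (simp add: algebra_simps)
  then show ?thesis using 1 by simp
qed

section \<open>Normal and angular derivatives on a mirror\<close>

lemma ring_map_C: "ring_map (\<lambda>c::'a::comm_ring_1. [:c:])"
  by unfold_locales (auto simp: one_pCons)

text \<open>Restriction to the line orthogonal to \<open>v\<close>, parametrised by the multiples of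
  \<open>perp v\<close>. Vanishing on the line becomes a polynomial identity in the
  parameter.\<close>

definition restr :: "real ^ 2 \<Rightarrow> bipoly \<Rightarrow> complex poly" where
  "restr v = subst2 (\<lambda>c. [:c:]) [:0, of_real (v $ 2):] [:0, - of_real (v $ 1):]"

interpretation restr: ring_map "restr v" for v
  unfolding restr_def by (intro ring_map_subst2 ring_map_C)

lemma restr_simps: "restr v (Const c) = [:c:]" "restr v X1 = [:0, of_real (v $ 2):]"
  "restr v X2 = [:0, - of_real (v $ 1):]"
  by (simp_all add: restr_def subst2_simps[OF ring_map_C])

lemma pderiv_restr: "pderiv (restr v p) = restr v (dir_deriv (perp v) p)"
proof (induction p rule: bipoly_induct)
  case (Const c)
  then show ?case by (simp add: restr_simps dir_deriv_Const restr.zero pderiv_pCons)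
qed (simp_all add: restr.add restr.mult pderiv_add dir_deriv_add pderiv_mult dir_deriv_mult
    restr_simps pderiv_pCons pderiv_smult pderiv_minus dir_deriv_X1 dir_deriv_X2)

lemma eval2_line: "eval2 p (r *\<^sub>R perp v) = poly (restr v p) (of_real r)"
  by (induction p rule: bipoly_induct)
    (simp_all add: restr.add restr.mult restr_simps eval2.add eval2.mult)

lemma on_line:
  assumes "(v $ 1)\<^sup>2 + (v $ 2)\<^sup>2 = 1" "v \<bullet> x = 0"
  shows "\<exists>r. x = r *\<^sub>R perp v"
proof
  have 0: "v $ 1 * x $ 1 + v $ 2 * x $ 2 = 0" using assms(2) by (simp add: inner_vec_def UNIV_2)
  have "x $ 1 = ((v $ 1)\<^sup>2 + (v $ 2)\<^sup>2) * x $ 1 - v $ 1 * (v $ 1 * x $ 1 + v $ 2 * x $ 2)"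
    using assms(1) 0 by simp
  moreover have "x $ 2 = ((v $ 1)\<^sup>2 + (v $ 2)\<^sup>2) * x $ 2 - v $ 2 * (v $ 1 * x $ 1 + v $ 2 * x $ 2)"
    using assms(1) 0 by simp
  ultimately show "x = (v $ 2 * x $ 1 - v $ 1 * x $ 2) *\<^sub>R perp v"
    by (simp add: vec_eq_iff forall_2 power2_eq_square algebra_simps)
qed

lemma vanishes_on_line_iff:
  assumes "(v $ 1)\<^sup>2 + (v $ 2)\<^sup>2 = 1"
  shows "(\<forall>x. v \<bullet> x = 0 \<longrightarrow> eval2 p x = 0) \<longleftrightarrow> restr v p = 0"
proof
  assume *: "\<forall>x. v \<bullet> x = 0 \<longrightarrow> eval2 p x = 0"
  show "restr v p = 0"
  proof (rule poly_eq_0_if_real)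
    fix r
    have "v \<bullet> (r *\<^sub>R perp v) = 0" by (simp add: inner_vec_def UNIV_2)
    then show "poly (restr v p) (of_real r) = 0" using * by (simp flip: eval2_line)
  qed
next
  assume "restr v p = 0"
  then show "\<forall>x. v \<bullet> x = 0 \<longrightarrow> eval2 p x = 0"
    using on_line[OF assms] by (metis eval2_line poly_0)
qed

text \<open>\<open>par v 0 M p\<close> says that, to order \<open>M\<close>, \<open>p\<close> is even under the reflection in the
  line orthogonal to \<open>v\<close>, and \<open>par v 1 M p\<close> that it is odd.\<close>

definition par :: "real ^ 2 \<Rightarrow> nat \<Rightarrow> nat \<Rightarrow> bipoly \<Rightarrow> bool" where
  "par v b M p \<longleftrightarrow> (\<forall>i<M. odd (i + b) \<longrightarrow> restr v ((dir_deriv v ^^ i) p) = 0)"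

text \<open>One normal derivative flips the parity. Only the parity of \<open>b\<close> matters, so
  it can simply be counted upwards in inductions on the order.\<close>

lemma par_Suc:
  "par v b (Suc M) p \<longleftrightarrow> (odd b \<longrightarrow> restr v p = 0) \<and> par v (Suc b) M (dir_deriv v p)"
  unfolding par_def All_less_Suc2 by (simp add: funpow_Suc_right del: funpow.simps)

lemma par_Suc_Suc: "par v (Suc (Suc b)) M p = par v b M p"
  by (simp add: par_def)

lemma par_mono: "par v b M p \<Longrightarrow> L \<le> M \<Longrightarrow> par v b L p"
  by (simp add: par_def)

lemma dir_deriv_pow_add: "(dir_deriv v ^^ s) (p + q) = (dir_deriv v ^^ s) p + (dir_deriv v ^^ s) q"
  by (induction s) (auto simp: dir_deriv_add)

lemma dir_deriv_0: "dir_deriv v 0 = 0" and dir_deriv_1: "dir_deriv v 1 = 0"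
  using dir_deriv_Const[of v 0] dir_deriv_Const[of v 1] by (simp_all add: Const.zero Const.one)

lemma dir_deriv_pow_0: "(dir_deriv v ^^ s) 0 = 0"
  by (induction s) (auto simp: dir_deriv_0)

lemma dir_deriv_minus: "dir_deriv v (- p) = - dir_deriv v p"
  using dir_deriv_add[of v p "- p"] by (simp add: dir_deriv_0 eq_neg_iff_add_eq_0 add.commute)

lemma dir_deriv_pow_minus: "(dir_deriv v ^^ s) (- p) = - (dir_deriv v ^^ s) p"
  by (induction s) (auto simp: dir_deriv_minus)

lemma dir_deriv_pow_diff: "(dir_deriv v ^^ s) (p - q) = (dir_deriv v ^^ s) p - (dir_deriv v ^^ s) q"
  using dir_deriv_pow_add[of s v p "- q"] by (simp add: dir_deriv_pow_minus)

lemma dir_deriv_pow_commute: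
  "(dir_deriv v ^^ s) (dir_deriv w p) = dir_deriv w ((dir_deriv v ^^ s) p)"
  by (induction s) (auto simp: dir_deriv_commute)

lemma par_0: "par v b M 0"
  by (simp add: par_def dir_deriv_pow_0 restr.zero)

lemma par_add: "par v b M p \<Longrightarrow> par v b M q \<Longrightarrow> par v b M (p + q)"
  by (simp add: par_def dir_deriv_pow_add restr.add)

lemma par_minus: "par v b M p \<Longrightarrow> par v b M (- p)"
  by (simp add: par_def dir_deriv_pow_minus restr.minus)

lemma par_diff: "par v b M p \<Longrightarrow> par v b M q \<Longrightarrow> par v b M (p - q)"
  using par_add[of v b M p "- q"] par_minus[of v b M q] by simp

text \<open>Parities add, as for power series in the normal coordinate. By the Leibniz rule, each
  derivative of the product is handled by the induction hypothesis for two products of lower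
  order.\<close>

lemma par_mult: "par v b M p \<Longrightarrow> par v c M q \<Longrightarrow> par v (b + c) M (p * q)"
proof (induction M arbitrary: b c p q)
  case 0
  then show ?case by (simp add: par_def)
next
  case (Suc M)
  have "par v b M p" "par v c M q" using Suc.prems par_mono le_SucI le_refl by metis+
  moreover have "par v (Suc b) M (dir_deriv v p)" "par v (Suc c) M (dir_deriv v q)"
    and "odd (b + c) \<Longrightarrow> restr v p = 0 \<or> restr v q = 0"
    using Suc.prems by (auto simp: par_Suc)
  ultimately show ?case
    using Suc.IH[of "Suc b" "dir_deriv v p" c q] Suc.IH[of b p "Suc c" "dir_deriv v q"]
    by (auto simp: par_Suc dir_deriv_mult restr.mult intro!: par_add)
qed

lemma par_1: "par v 0 M 1"
  by (cases M) (auto simp: par_Suc dir_deriv_1 par_0 par_def[of _ _ 0])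

lemma par_dir_deriv_perp: "par v b M p \<Longrightarrow> par v b M (dir_deriv (perp v) p)"
  by (auto simp: par_def dir_deriv_pow_commute simp flip: pderiv_restr)

lemma restr_lin: "restr v (lin v) = 0"
  by (simp add: lin_def restr.hom_simps restr_simps)

lemma unit_complex:
  assumes "(v $ 1)\<^sup>2 + (v $ 2)\<^sup>2 = (1 :: real)"
  shows "complex_of_real (v $ 1) * complex_of_real (v $ 1) +
    complex_of_real (v $ 2) * complex_of_real (v $ 2) = 1"
  using assms by (simp add: power2_eq_square flip: of_real_mult of_real_add)

lemma restr_lin_perp:
  assumes "(v $ 1)\<^sup>2 + (v $ 2)\<^sup>2 = 1"
  shows "restr v (lin (perp v)) = [:0, 1:]"
  using unit_complex[OF assms] by (simp add: lin_def restr.hom_simps restr_simps add.commute)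

lemma dir_deriv_lin:
  assumes "(v $ 1)\<^sup>2 + (v $ 2)\<^sup>2 = 1"
  shows "dir_deriv v (lin v) = 1"
  by (simp add: lin_def dir_deriv_add dir_deriv_mult dir_deriv_Const dir_deriv_X1 dir_deriv_X2
      Const.one unit_complex[OF assms] flip: Const.mult Const.add)

lemma dir_deriv_lin_perp: "dir_deriv v (lin (perp v)) = 0"
  by (simp add: lin_def dir_deriv_add dir_deriv_mult dir_deriv_Const dir_deriv_X1 dir_deriv_X2
    flip: Const.mult Const.add Const.one) (simp add: Const.hom_simps mult.commute)

lemma par_lin_perp: "par v 0 M (lin (perp v))"
  by (cases M) (auto simp: par_Suc dir_deriv_lin_perp par_0 par_def[of _ _ 0])

lemma par_lin:
  assumes "(v $ 1)\<^sup>2 + (v $ 2)\<^sup>2 = 1"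
  shows "par v 1 M (lin v)"
  by (cases M) (auto simp: par_Suc restr_lin dir_deriv_lin[OF assms] par_1 par_Suc_Suc par_def[of _ _ 0])

text \<open>Both terms of \<open>rotd_split\<close> flip the parity: the first differentiates once
  in the normal direction, which costs one order, and the second multiplies by the odd function
  \<open>lin v\<close>.\<close>

lemma par_rotd:
  assumes v: "(v $ 1)\<^sup>2 + (v $ 2)\<^sup>2 = 1" and p: "par v b (Suc M) p"
  shows "par v (Suc b) M (rotd p)"
proof -
  have "par v (0 + Suc b) M (lin (perp v) * dir_deriv v p)"
    using p by (intro par_mult par_lin_perp) (simp add: par_Suc)
  moreover have "par v (1 + b) M (lin v * dir_deriv (perp v) p)"
    using par_mono[OF p, of M] by (intro par_mult par_lin[OF v] par_dir_deriv_perp) simp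
  ultimately show ?thesis
    unfolding rotd_split[OF v] by (intro par_diff) simp_all
qed

section \<open>Equivalence of normal and angular vanishing conditions\<close>

lemma dir_deriv_pow_lin_perp_mult:
  "(dir_deriv v ^^ K) (lin (perp v) * p) = lin (perp v) * (dir_deriv v ^^ K) p"
  by (induction K) (auto simp: dir_deriv_mult dir_deriv_lin_perp)

lemma dir_deriv_pow_lin_mult:
  assumes v: "(v $ 1)\<^sup>2 + (v $ 2)\<^sup>2 = 1"
  shows "(dir_deriv v ^^ Suc K) (lin v * p) =
    lin v * (dir_deriv v ^^ Suc K) p + of_nat (Suc K) * (dir_deriv v ^^ K) p"
proof (induction K)
  case 0
  then show ?case by (simp add: dir_deriv_mult dir_deriv_lin[OF v] algebra_simps)
next
  case (Suc K)
  have n: "dir_deriv v (of_nat n) = 0" for n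
    by (induction n) (auto simp: dir_deriv_0 dir_deriv_1 dir_deriv_add)
  have "(dir_deriv v ^^ Suc (Suc K)) (lin v * p) =
    dir_deriv v (lin v * (dir_deriv v ^^ Suc K) p + of_nat (Suc K) * (dir_deriv v ^^ K) p)"
    using Suc by simp
  then show ?case
    unfolding dir_deriv_add dir_deriv_mult dir_deriv_lin[OF v] n by (simp add: algebra_simps)
qed

text \<open>In the second term of \<open>rotd_split\<close> the factor \<open>lin v\<close> vanishes
  on the mirror unless it is differentiated. What remains is a multiple of the tangential derivative
  of the normal derivative of order \<open>K - 1\<close>, which vanishes on the mirror by
  parity.\<close>

lemma restr_dir_deriv_pow_rotd:
  assumes v: "(v $ 1)\<^sup>2 + (v $ 2)\<^sup>2 = 1" and p: "par v b (Suc K) p" and odd: "odd (Suc K + b)"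
  shows "restr v ((dir_deriv v ^^ K) (rotd p)) = [:0, 1:] * restr v ((dir_deriv v ^^ Suc K) p)"
proof -
  have "restr v ((dir_deriv v ^^ K) (lin v * dir_deriv (perp v) p)) = 0"
  proof (cases K)
    case 0
    then show ?thesis by (simp add: restr.mult restr_lin)
  next
    case (Suc L)
    then have "restr v ((dir_deriv v ^^ L) p) = 0" using p odd by (auto simp: par_def)
    then have "restr v (dir_deriv (perp v) ((dir_deriv v ^^ L) p)) = 0"
      by (simp flip: pderiv_restr)
    then show ?thesis
      by (simp only: Suc dir_deriv_pow_lin_mult[OF v] restr.add restr.mult restr_lin dir_deriv_pow_commute) simp
  qed
  then show ?thesis
    unfolding rotd_split[OF v] dir_deriv_pow_diff restr.diff dir_deriv_pow_lin_perp_mult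
      restr.mult restr_lin_perp[OF v]
    by (simp add: funpow_Suc_right del: funpow.simps)
qed

text \<open>Iterating the previous lemma collects one tangential coordinate per angular derivative.
  The factor \<open>[:0, 1:] ^ M\<close> is nonzero, so the two restrictions vanish
  together.\<close>

lemma restr_rotd_pow:
  assumes v: "(v $ 1)\<^sup>2 + (v $ 2)\<^sup>2 = 1" and "par v b M p" "odd (M + b)"
  shows "restr v ((rotd ^^ M) p) = [:0, 1:] ^ M * restr v ((dir_deriv v ^^ M) p)"
  using assms(2,3)
proof (induction M arbitrary: b p)
  case (Suc M)
  then have "restr v ((rotd ^^ M) (rotd p)) = [:0, 1:] ^ M * restr v ((dir_deriv v ^^ M) (rotd p))"
    using Suc.IH[of "Suc b"] par_rotd[OF v Suc.prems(1)] by simp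
  then show ?case
    unfolding restr_dir_deriv_pow_rotd[OF v Suc.prems]
    by (simp only: funpow_Suc_right comp_def power_Suc mult_ac)
qed simp

lemma par_iff_rotd:
  assumes v: "(v $ 1)\<^sup>2 + (v $ 2)\<^sup>2 = 1"
  shows "par v 0 M p \<longleftrightarrow> (\<forall>i<M. odd i \<longrightarrow> restr v ((rotd ^^ i) p) = 0)"
proof
  assume "par v 0 M p"
  moreover from this have "par v 0 i p" if "i < M" for i using that par_mono less_imp_le by blast
  ultimately show "\<forall>i<M. odd i \<longrightarrow> restr v ((rotd ^^ i) p) = 0"
    using restr_rotd_pow[OF v, where b = 0] unfolding par_def by auto
next
  assume *: "\<forall>i<M. odd i \<longrightarrow> restr v ((rotd ^^ i) p) = 0"
  \<comment> \<open>The passage from angular to normal derivatives is triangular: the conditions of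
    order below \<open>i\<close> give \<open>par v 0 i p\<close>, which is what the comparison at
    order \<open>i\<close> requires.\<close>
  have "odd i \<longrightarrow> restr v ((dir_deriv v ^^ i) p) = 0" if "i < M" for i
    using that
  proof (induction i rule: less_induct)
    case (less i)
    show ?case
    proof
      assume "odd i"
      have "par v 0 i p" using less by (auto simp: par_def)
      from restr_rotd_pow[OF v this] \<open>odd i\<close> less.prems *
      show "restr v ((dir_deriv v ^^ i) p) = 0" by simp
    qed
  qed
  then show "par v 0 M p" by (simp add: par_def)
qed

section \<open>The mirrors of the dihedral group\<close>

lemma root_vec_simps [simp]: "root_vec N j $ 1 = - sin (pi * real j / real N)"
  "root_vec N j $ 2 = cos (pi * real j / real N)"
  by (simp_all add: root_vec_def)

lemma root_vec_unit: "(root_vec N j $ 1)\<^sup>2 + (root_vec N j $ 2)\<^sup>2 = 1"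
  by simp

lemma quasiinvariants_par: "q \<in> quasiinvariants N m \<longleftrightarrow> (\<forall>j<N. par (root_vec N j) 0 (2 * m) q)"
  unfolding quasiinvariants_def mem_Collect_eq vanishes_on_line_iff[OF root_vec_unit] par_def
  by auto

lemma quasiinvariants_rotd: "q \<in> quasiinvariants N m \<longleftrightarrow>
    (\<forall>j<N. \<forall>s<2*m. odd s \<longrightarrow> restr (root_vec N j) ((rotd ^^ s) q) = 0)"
  unfolding quasiinvariants_par par_iff_rotd[OF root_vec_unit] by auto

lemma is_subring_quasiinvariants: "is_subring (quasiinvariants N m)"
  unfolding is_subring_def
  by (auto simp: quasiinvariants_par par_0 par_1 par_add par_minus
    intro: par_mult[where b = 0 and c = 0, simplified])

lemma restr_ZZ: "restr (root_vec N j) Z = [:0, cis (pi * real j / real N):]"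
    "restr (root_vec N j) Zbar = [:0, cnj (cis (pi * real j / real N)):]"
  by (simp_all add: Z_def Zbar_def restr.hom_simps restr_simps complex_eq_iff)

section \<open>Invariants and explicit quasiinvariants\<close>

text \<open>Composition with the reflection, as a substitution homomorphism. The formula is
  normalised for a unit vector \<open>v\<close>.\<close>

definition refl_map :: "real ^ 2 \<Rightarrow> bipoly \<Rightarrow> bipoly" where
  "refl_map v = subst2 Const (X1 - Const (2 * of_real (v $ 1)) * lin v)
    (X2 - Const (2 * of_real (v $ 2)) * lin v)"

lemma ring_map_Const: "ring_map Const"
  by unfold_locales

interpretation refl_map: ring_map "refl_map v" for v
  unfolding refl_map_def by (intro ring_map_subst2 ring_map_Const)

lemma refl_map_simps: "refl_map v (Const c) = Const c"
  "refl_map v X1 = X1 - Const (2 * of_real (v $ 1)) * lin v"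
  "refl_map v X2 = X2 - Const (2 * of_real (v $ 2)) * lin v"
  by (simp_all add: refl_map_def subst2_simps[OF ring_map_Const])

lemma eval2_lin: "eval2 (lin v) x = of_real (v \<bullet> x)"
  by (simp add: lin_def eval2.hom_simps inner_vec_def UNIV_2)

lemma unit_inner: "(v $ 1)\<^sup>2 + (v $ 2)\<^sup>2 = 1 \<Longrightarrow> v \<bullet> v = (1 :: real)" for v :: "real ^ 2"
  by (simp add: inner_vec_def UNIV_2 power2_eq_square)

lemma eval2_refl_map:
  assumes "(v $ 1)\<^sup>2 + (v $ 2)\<^sup>2 = 1"
  shows "eval2 (refl_map v p) x = eval2 p (reflection v x)"
  by (induction p rule: bipoly_induct)
    (simp_all add: refl_map.add refl_map.mult refl_map_simps eval2.hom_simps eval2_lin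
      reflection_def unit_inner[OF assms])

lemma reflection_involution:
  assumes "(v $ 1)\<^sup>2 + (v $ 2)\<^sup>2 = 1"
  shows "reflection v (reflection v x) = x"
  using unit_inner[OF assms]
  by (simp add: reflection_def inner_diff_right)

lemma reflection_Bij:
  assumes "(v $ 1)\<^sup>2 + (v $ 2)\<^sup>2 = 1"
  shows "reflection v \<in> Bij UNIV"
proof -
  have "bij (reflection v)"
    using reflection_involution[OF assms] by (intro bij_betwI[where g = "reflection v"]) auto
  then show ?thesis by (simp add: Bij_def)
qed

lemma generate_BijGroup_preserves:
  assumes "g \<in> generate (BijGroup UNIV) S" "S \<subseteq> Bij UNIV" and "\<And>s x. s \<in> S \<Longrightarrow> f (s x) = f x"
  shows "f (g x) = f x"
  using assms(1)
proof (induction arbitrary: x rule: generate.induct)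
  case one
  then show ?case by (simp add: BijGroup_def)
next
  case (incl s)
  then show ?case using assms(3) by simp
next
  case (inv s)
  then have s: "s \<in> Bij UNIV" using assms(2) by auto
  then have "s (inv_into UNIV s x) = x" by (simp add: Bij_def bij_betw_def f_inv_into_f)
  then have "f (inv_into UNIV s x) = f x" using assms(3)[OF inv] by metis
  then show ?case using inv_BijGroup[OF s] by simp
next
  case (eng g h)
  \<comment> \<open>The product of \<open>BijGroup\<close> is composition only on its
    carrier.\<close>
  have "generate (BijGroup UNIV) S \<subseteq> carrier (BijGroup UNIV)"
    using assms(2) group.generate_incl[OF group_BijGroup] by (metis BijGroup_def partial_object.select_convs(1))
  then show ?case using eng by (auto simp: BijGroup_def compose_def)
qed

text \<open>Invariance passes from the generating reflections to the group, and equality of values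
  on the real plane is equality of polynomials.\<close>

lemma invariants_iff: "p \<in> invariants N \<longleftrightarrow> (\<forall>j<N. refl_map (root_vec N j) p = p)"
proof
  assume p: "p \<in> invariants N"
  show "\<forall>j<N. refl_map (root_vec N j) p = p"
  proof (intro allI impI eval2_eqI)
    fix j x assume "j < N"
    then have "reflection (root_vec N j) \<in> dihedral N"
      unfolding dihedral_def by (intro generate.incl) auto
    then show "eval2 (refl_map (root_vec N j) p) x = eval2 p x"
      using p by (simp add: eval2_refl_map[OF root_vec_unit] invariants_def)
  qed
next
  assume *: "\<forall>j<N. refl_map (root_vec N j) p = p"
  have "eval2 p (g x) = eval2 p x" if "g \<in> dihedral N" for g x
    using that unfolding dihedral_def
  proof (rule generate_BijGroup_preserves)
    show "(\<lambda>j. reflection (root_vec N j)) ` {..<N} \<subseteq> Bij UNIV"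
      using reflection_Bij[OF root_vec_unit] by auto
    show "eval2 p (s x) = eval2 p x" if "s \<in> (\<lambda>j. reflection (root_vec N j)) ` {..<N}" for s x
      using that * by (auto simp flip: eval2_refl_map[OF root_vec_unit])
  qed
  then show "p \<in> invariants N" by (auto simp: invariants_def)
qed

lemma invariants_add: "p \<in> invariants N \<Longrightarrow> q \<in> invariants N \<Longrightarrow> p + q \<in> invariants N"
  and invariants_mult: "p \<in> invariants N \<Longrightarrow> q \<in> invariants N \<Longrightarrow> p * q \<in> invariants N"
  and invariants_minus: "p \<in> invariants N \<Longrightarrow> - p \<in> invariants N"
  and invariants_Const: "Const c \<in> invariants N"
  by (auto simp: invariants_iff refl_map.hom_simps refl_map_simps)

lemma invariants_0: "0 \<in> invariants N" and invariants_1: "1 \<in> invariants N"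
  using invariants_Const[of 0 N] invariants_Const[of 1 N] by (auto simp: Const.hom_simps)

lemma invariants_power: "p \<in> invariants N \<Longrightarrow> p ^ n \<in> invariants N"
  by (induction n) (auto intro: invariants_mult invariants_1)

lemma is_subring_invariants: "is_subring (invariants N)"
  by (auto simp: is_subring_def intro: invariants_0 invariants_1 invariants_add invariants_mult invariants_minus)

lemma restr_refl_map: "restr v (refl_map v p) = restr v p"
  by (induction p rule: bipoly_induct)
    (simp_all add: refl_map.hom_simps refl_map_simps restr.hom_simps restr_lin)

lemma dir_deriv_refl_map:
  assumes "(v $ 1)\<^sup>2 + (v $ 2)\<^sup>2 = 1"
  shows "dir_deriv v (refl_map v p) = - refl_map v (dir_deriv v p)"
proof -
  have *: "dir_deriv v (p - q) = dir_deriv v p - dir_deriv v q" for p q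
    using dir_deriv_pow_diff[of 1] by simp
  have two: "dir_deriv v 2 = 0"
    using dir_deriv_Const[of v 2] Const.add[of 1 1] by (simp add: Const.one)
  show ?thesis
    by (induction p rule: bipoly_induct)
      (simp_all add: refl_map.hom_simps refl_map_simps dir_deriv_Const dir_deriv_X1 dir_deriv_X2
        dir_deriv_add dir_deriv_mult * dir_deriv_lin[OF assms] Const.hom_simps algebra_simps
        two Const.add[of 1 1, simplified])
qed

lemma dir_deriv_pow_refl_map:
  assumes "(v $ 1)\<^sup>2 + (v $ 2)\<^sup>2 = 1"
  shows "(dir_deriv v ^^ s) (refl_map v p) = (- 1) ^ s * refl_map v ((dir_deriv v ^^ s) p)"
proof (induction s)
  case (Suc s)
  have "(- 1 :: bipoly) ^ s = Const ((- 1) ^ s)" by (simp add: Const.hom_simps)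
  then show ?case
    by (simp add: Suc dir_deriv_mult dir_deriv_Const dir_deriv_refl_map[OF assms])
qed simp

text \<open>Each normal derivative changes sign under the reflection, while restriction to the
  mirror does not see the reflection. An odd derivative on the mirror therefore equals its own
  negative.\<close>

lemma par_if_refl_map_eq:
  assumes v: "(v $ 1)\<^sup>2 + (v $ 2)\<^sup>2 = 1" and "refl_map v p = p"
  shows "par v 0 M p"
  unfolding par_def
proof (intro allI impI)
  fix s :: nat assume "odd (s + 0)"
  then have "restr v ((dir_deriv v ^^ s) (refl_map v p)) = - restr v ((dir_deriv v ^^ s) p)"
    unfolding dir_deriv_pow_refl_map[OF v] by (simp add: restr.hom_simps restr_refl_map)
  then show "restr v ((dir_deriv v ^^ s) p) = 0"
    unfolding assms(2) by simp
qed

lemma invariants_subset_quasiinvariants: "invariants N \<subseteq> quasiinvariants N m"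
  using par_if_refl_map_eq[OF root_vec_unit] by (auto simp: invariants_iff quasiinvariants_par)

text \<open>With the unit complex number \<open>w\<close> representing \<open>v\<close>, the
  reflection sends \<open>Z\<close> to \<open>Z\<close> minus \<open>w\<close> times
  \<open>2 * lin v\<close>, and \<open>2 * lin v\<close> is \<open>cnj w * Z + w * Zbar\<close>; the
  terms in \<open>Z\<close> cancel.\<close>

lemma refl_map_Z:
  assumes "(v $ 1)\<^sup>2 + (v $ 2)\<^sup>2 = 1"
  shows "refl_map v Z = Const (- (Complex (v $ 1) (v $ 2))\<^sup>2) * Zbar"
    and "refl_map v Zbar = Const (- (cnj (Complex (v $ 1) (v $ 2)))\<^sup>2) * Z"
proof -
  define w where "w = Complex (v $ 1) (v $ 2)"
  have lin: "Const 2 * lin v = Const (cnj w) * Z + Const w * Zbar"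
    by (simp add: lin_def w_def Z_def Zbar_def Const_def X1_def X2_def complex_eq_iff)
  have w1: "w * cnj w = 1"
    using assms by (simp add: w_def complex_eq_iff power2_eq_square)
  have w: "Const w = Const (of_real (v $ 1)) + Const \<i> * Const (of_real (v $ 2))"
    "Const (cnj w) = Const (of_real (v $ 1)) - Const \<i> * Const (of_real (v $ 2))"
    by (simp_all add: w_def Complex_eq flip: Const.add Const.mult Const.diff)
  have "refl_map v Z = Z - Const w * (Const 2 * lin v)"
    by (simp add: refl_map.hom_simps refl_map_simps Z_def w Const.mult algebra_simps)
  also have "\<dots> = Z - Const (w * cnj w) * Z - Const (w * w) * Zbar"
    unfolding lin Const.mult by (simp add: algebra_simps)
  finally show "refl_map v Z = Const (- (Complex (v $ 1) (v $ 2))\<^sup>2) * Zbar"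
    by (simp add: w1 power2_eq_square Const.hom_simps flip: w_def)
  have "refl_map v Zbar = Zbar - Const (cnj w) * (Const 2 * lin v)"
    by (simp add: refl_map.hom_simps refl_map_simps Zbar_def w Const.mult algebra_simps)
  also have "\<dots> = Zbar - Const (w * cnj w) * Zbar - Const (cnj w * cnj w) * Z"
    unfolding lin Const.mult by (simp add: algebra_simps)
  finally show "refl_map v Zbar = Const (- (cnj (Complex (v $ 1) (v $ 2)))\<^sup>2) * Z"
    by (simp add: w1 power2_eq_square Const.hom_simps flip: w_def)
qed

text \<open>The direction of the \<open>j\<close>-th mirror as a unit complex number;
  \<open>root_vec N j\<close> is this direction turned by a right angle.\<close>

definition eps :: "nat \<Rightarrow> nat \<Rightarrow> complex" where
  "eps N j = cis (pi * real j / real N)"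

lemma eps_cnj: "eps N j * cnj (eps N j) = 1" "cnj (eps N j) * eps N j = 1"
  by (simp_all add: eps_def complex_eq_iff)

lemma eps_pow_N:
  assumes "N > 0"
  shows "eps N j ^ N = (- 1) ^ j"
proof -
  have "real N * (pi * real j / real N) = real j * pi" using assms by simp
  then have "eps N j ^ N = cis (real j * pi)" by (simp only: eps_def Complex.DeMoivre)
  also have "\<dots> = cis pi ^ j" by (simp only: Complex.DeMoivre)
  finally show ?thesis by simp
qed

text \<open>The power is a sign, hence real. Consequently \<open>Z ^ N\<close> and
  \<open>Zbar ^ N\<close> coincide on every mirror.\<close>

lemma eps_pow_N_cnj: "N > 0 \<Longrightarrow> cnj (eps N j) ^ N = eps N j ^ N"
  unfolding complex_cnj_power[symmetric] by (simp only: eps_pow_N) simp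

lemma refl_map_root:
  "refl_map (root_vec N j) Z = Const (eps N j ^ 2) * Zbar"
  "refl_map (root_vec N j) Zbar = Const (cnj (eps N j) ^ 2) * Z"
proof -
  have "Complex (root_vec N j $ 1) (root_vec N j $ 2) = \<i> * eps N j"
    by (simp add: eps_def complex_eq_iff)
  then show "refl_map (root_vec N j) Z = Const (eps N j ^ 2) * Zbar"
    "refl_map (root_vec N j) Zbar = Const (cnj (eps N j) ^ 2) * Z"
    by (simp_all add: refl_map_Z[OF root_vec_unit] power_mult_distrib)
qed

lemma restr_root: "restr (root_vec N j) Z = monom (eps N j) 1"
    "restr (root_vec N j) Zbar = monom (cnj (eps N j)) 1"
  by (simp_all add: restr_ZZ eps_def monom_altdef)

lemma restr_rotd_pow_mono:
  "restr (root_vec N j) ((rotd ^^ s) (Const c * Z ^ a * Zbar ^ b)) =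
    monom (c * (\<i> * (of_nat a - of_nat b)) ^ s * (eps N j ^ a * cnj (eps N j) ^ b)) (a + b)"
  unfolding rotd_pow_mono
  by (simp add: restr.hom_simps restr_simps restr_root monom_power mult_monom smult_monom mult_ac)

lemma invariants_norm: "Z * Zbar \<in> invariants N"
proof -
  have "Const (eps N j ^ 2) * Zbar * (Const (cnj (eps N j) ^ 2) * Z) =
    Const ((eps N j * cnj (eps N j)) ^ 2) * (Z * Zbar)" for j
    by (simp only: power_mult_distrib Const.mult mult_ac)
  then show ?thesis
    by (simp add: invariants_iff refl_map.hom_simps refl_map_root eps_cnj Const.one)
qed

lemma invariants_power_sum:
  assumes "N > 0"
  shows "Z ^ N + Zbar ^ N \<in> invariants N"
proof -
  have "(eps N j ^ 2) ^ N = 1" "(cnj (eps N j) ^ 2) ^ N = 1" for j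
    by (simp_all only: power_mult[symmetric] mult.commute[of 2 N])
      (cases "even j"; simp add: power_mult eps_pow_N_cnj eps_pow_N assms)+
  then show ?thesis
    by (simp add: invariants_iff refl_map.hom_simps refl_map_root power_mult_distrib add.commute
      Const.one flip: Const.power)
qed

section \<open>Quasiinvariance of the explicit generators\<close>

lemma vanishing_order_mult:
  assumes "\<And>i. i < k \<Longrightarrow> restr v ((dir_deriv v ^^ i) p) = 0"
    and "\<And>i. i < l \<Longrightarrow> restr v ((dir_deriv v ^^ i) q) = 0"
    and "i < k + l"
  shows "restr v ((dir_deriv v ^^ i) (p * q)) = 0"
  using assms
proof (induction i arbitrary: k l p q)
  case 0
  then show ?case by (cases k) (auto simp: restr.mult dest: meta_spec[where x = 0])
next
  case (Suc i)
  have "restr v ((dir_deriv v ^^ i) (dir_deriv v p * q)) = 0"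
  \<comment> \<open>Truncated subtraction is harmless: for \<open>k = 0\<close> the bound
    \<open>Suc i < l\<close> already gives \<open>i < l\<close>.\<close>
  proof (rule Suc.IH[where k = "k - 1" and l = l])
    show "restr v ((dir_deriv v ^^ i) (dir_deriv v p)) = 0" if "i < k - 1" for i
      using Suc.prems(1)[of "Suc i"] that by (simp add: funpow_Suc_right del: funpow.simps)
  qed (use Suc.prems in auto)
  moreover have "restr v ((dir_deriv v ^^ i) (p * dir_deriv v q)) = 0"
  proof (rule Suc.IH[where k = k and l = "l - 1"])
    show "restr v ((dir_deriv v ^^ i) (dir_deriv v q)) = 0" if "i < l - 1" for i
      using Suc.prems(2)[of "Suc i"] that by (simp add: funpow_Suc_right del: funpow.simps)
  qed (use Suc.prems in auto)
  ultimately show ?case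
    by (simp add: funpow_Suc_right dir_deriv_mult dir_deriv_pow_add restr.add del: funpow.simps)
qed

lemma vanishing_order_power:
  assumes "restr v p = 0" "i < n"
  shows "restr v ((dir_deriv v ^^ i) (p ^ n)) = 0"
  using assms(2)
proof (induction n arbitrary: i)
  case (Suc n)
  show ?case
    unfolding power_Suc
    by (rule vanishing_order_mult[where k = 1 and l = n]) (use Suc assms(1) in auto)
qed simp

text \<open>The base of the power vanishes on every mirror, so its power \<open>2 * m + 1\<close>
  vanishes there together with all normal derivatives of order at most \<open>2 * m\<close>.\<close>

lemma q_last_quasiinvariant:
  assumes "N > 0"
  shows "q_last N m \<in> quasiinvariants N m"
proof -
  have "restr (root_vec N j) (Z ^ N - Zbar ^ N) = 0" for j
    by (simp add: restr.hom_simps restr_root monom_power flip: complex_cnj_power)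
      (simp add: eps_pow_N[OF assms])
  then show ?thesis
    unfolding quasiinvariants_par par_def q_last_def
    by (intro allI impI vanishing_order_power) auto
qed

text \<open>Used with \<open>eps N k\<close> and its conjugate for \<open>x\<close> and
  \<open>y\<close>: on a given mirror all monomials of one generator restrict to the same power up
  to their coefficients.\<close>

lemma power_mixed:
  fixes x y :: "'a::comm_monoid_mult"
  assumes "y ^ N = x ^ N" "t \<le> m"
  shows "x ^ ((m - t) * N + j) * y ^ (t * N) = x ^ (m * N + j)"
proof -
  have "y ^ (t * N) = x ^ (t * N)" using assms(1) by (metis power_mult mult.commute)
  moreover have "(m - t) * N + j + t * N = m * N + j"
    using assms(2) by (metis add.commute add.left_commute add_mult_distrib le_add_diff_inverse)
  ultimately show ?thesis by (metis power_add)
qed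

lemma q_exponents:
  assumes "t \<le> m"
  shows "of_nat ((m - t) * N + j) - of_nat (t * N) =
      (of_int ((int m - 2 * int t) * int N + int j) :: 'a::comm_ring_1)"
    and "(m - t) * N + j + t * N = m * N + j"
proof -
  obtain e where "m = t + e" using le_Suc_ex assms by blast
  then show "of_nat ((m - t) * N + j) - of_nat (t * N) =
      (of_int ((int m - 2 * int t) * int N + int j) :: 'a::comm_ring_1)"
    "(m - t) * N + j + t * N = m * N + j"
    by (simp_all add: algebra_simps)
qed

lemma odd_below_double:
  assumes "s < 2 * m" "odd (s::nat)"
  shows "\<exists>r. s = 2 * r - 1 \<and> r \<in> {1..m}"
proof -
  from assms(2) obtain k where "s = 2 * k + 1" by (rule oddE)
  then show ?thesis using assms(1) by (intro exI[of _ "Suc k"]) auto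
qed

text \<open>On a mirror the monomials differ only by their coefficient and their angular eigenvalue.
  An odd angular derivative thus restricts to a multiple of one of the sums in the system defining
  \<open>a\<close>.\<close>

lemma q_poly_quasiinvariant:
  assumes "N > 0" and a: "coeff_solution N m j a"
  shows "q_poly N m j a \<in> quasiinvariants N m"
  unfolding quasiinvariants_rotd
proof (intro allI impI)
  fix k s :: nat
  assume s: "s < 2 * m" "odd s"
  then obtain r where r: "s = 2 * r - 1" "r \<in> {1..m}"
    using odd_below_double by blast
  let ?x = "\<lambda>t. (int m - 2 * int t) * int N + int j"
  have "restr (root_vec N k) ((rotd ^^ s) (Const (a t) * Zbar ^ (t * N) * Z ^ ((m - t) * N + j))) =
     monom (\<i> ^ s * eps N k ^ (m * N + j) * (of_int (?x t ^ s) * a t)) (m * N + j)"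
    if t: "t \<le> m" for t
  proof -
    have *: "Const (a t) * Zbar ^ (t * N) * Z ^ ((m - t) * N + j) =
      Const (a t) * Z ^ ((m - t) * N + j) * Zbar ^ (t * N)" by (simp only: mult_ac)
    show ?thesis
      unfolding * restr_rotd_pow_mono q_exponents[OF t] power_mixed[OF eps_pow_N_cnj[OF assms(1)] t]
      by (simp only: power_mult_distrib of_int_power mult_ac)
  qed
  then have "restr (root_vec N k) ((rotd ^^ s) (q_poly N m j a)) =
     monom (\<i> ^ s * eps N k ^ (m * N + j) * (\<Sum>t\<le>m. of_int (?x t ^ s) * a t)) (m * N + j)"
    unfolding q_poly_def rotd_pow_sum restr.sum by (simp add: sum_distrib_left monom_sum)
  also have "\<dots> = 0"
    using a r unfolding coeff_solution_def by simp
  finally show "restr (root_vec N k) ((rotd ^^ s) (q_poly N m j a)) = 0" .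
qed

lemma qbar_poly_quasiinvariant:
  assumes "N > 0" and a: "coeff_solution N m j a"
  shows "qbar_poly N m j a \<in> quasiinvariants N m"
  unfolding quasiinvariants_rotd
proof (intro allI impI)
  fix k s :: nat
  assume s: "s < 2 * m" "odd s"
  then obtain r where r: "s = 2 * r - 1" "r \<in> {1..m}"
    using odd_below_double by blast
  let ?x = "\<lambda>t. (int m - 2 * int t) * int N + int j"
  have "restr (root_vec N k) ((rotd ^^ s) (Const (cnj (a t)) * Z ^ (t * N) * Zbar ^ ((m - t) * N + j))) =
     monom ((- \<i>) ^ s * cnj (eps N k) ^ (m * N + j) * cnj (of_int (?x t ^ s) * a t)) (m * N + j)"
    if t: "t \<le> m" for t
  proof -
    have 1: "of_nat (t * N) - of_nat ((m - t) * N + j) = (- of_int (?x t) :: complex)"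
      using q_exponents(1)[OF t, of N j, where 'a = complex] by (metis minus_diff_eq)
    have 2: "t * N + ((m - t) * N + j) = m * N + j"
      using q_exponents(2)[OF t] by (metis add.commute)
    have 3: "eps N k ^ (t * N) * cnj (eps N k) ^ ((m - t) * N + j) = cnj (eps N k) ^ (m * N + j)"
      using power_mixed[OF eps_pow_N_cnj[OF assms(1), symmetric] t] by (metis mult.commute)
    have 4: "\<i> * - of_int (?x t) = - \<i> * of_int (?x t)" by (simp only: mult_minus_left mult_minus_right)
    show ?thesis
      unfolding restr_rotd_pow_mono 1 2 3 4
      by (simp only: power_mult_distrib of_int_power mult_ac complex_cnj_mult complex_cnj_power
          complex_cnj_of_int)
  qed
  then have "restr (root_vec N k) ((rotd ^^ s) (qbar_poly N m j a)) =
     monom ((- \<i>) ^ s * cnj (eps N k) ^ (m * N + j) * cnj (\<Sum>t\<le>m. of_int (?x t ^ s) * a t)) (m * N + j)"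
    unfolding qbar_poly_def rotd_pow_sum restr.sum cnj_sum by (simp add: sum_distrib_left monom_sum)
  also have "\<dots> = 0"
    using a r unfolding coeff_solution_def by simp
  finally show "restr (root_vec N k) ((rotd ^^ s) (qbar_poly N m j a)) = 0" .
qed

section \<open>Vandermonde systems and graded components\<close>

text \<open>The moments are paired with the odd polynomial whose value at \<open>y\<close> is
  \<open>y\<close> times \<open>g\<close> at the square of \<open>y\<close>. The factor
  \<open>g\<close> kills all nodes except \<open>t\<close>, and its degree is below
  \<open>m\<close>, so only the given moments enter.\<close>

lemma odd_moments_zero:
  fixes x a :: "'i \<Rightarrow> 'a::field"
  assumes "finite I" "card I \<le> m" and inj: "inj_on (\<lambda>t. (x t)\<^sup>2) I" and nz: "\<And>t. t \<in> I \<Longrightarrow> x t \<noteq> 0"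
    and mom: "\<And>s. odd s \<Longrightarrow> s < 2 * m \<Longrightarrow> (\<Sum>t\<in>I. x t ^ s * a t) = 0"
    and t: "t \<in> I"
  shows "a t = 0"
proof -
  define g where "g = (\<Prod>u\<in>I - {t}. [:- (x u)\<^sup>2, 1:])"
  have "degree g \<le> (\<Sum>u\<in>I - {t}. 1)"
    unfolding g_def using degree_prod_sum_le[of "I - {t}" "\<lambda>u. [:- (x u)\<^sup>2, 1:]"] assms(1)
    by (simp add: comp_def)
  also have "\<dots> < card I" using card_Diff1_less[OF assms(1) t] by simp
  finally have deg: "degree g < m" using assms(2) by simp
  have "(\<Sum>u\<in>I. a u * x u * poly g ((x u)\<^sup>2)) =
      (\<Sum>i\<le>degree g. coeff g i * (\<Sum>u\<in>I. x u ^ (2 * i + 1) * a u))"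
    unfolding poly_altdef sum_distrib_left
    by (subst sum.swap) (simp add: mult_ac flip: power_mult)
  also have "\<dots> = 0"
    using deg by (intro sum.neutral ballI) (subst mom, auto)
  also have "(\<Sum>u\<in>I. a u * x u * poly g ((x u)\<^sup>2)) = a t * x t * poly g ((x t)\<^sup>2)"
  proof (rule sum.remove[OF assms(1) t, THEN trans])
    have "(\<Sum>u\<in>I - {t}. a u * x u * poly g ((x u)\<^sup>2)) = 0"
      using assms(1) by (intro sum.neutral) (auto simp: g_def poly_prod)
    then show "a t * x t * poly g ((x t)\<^sup>2) + (\<Sum>u\<in>I - {t}. a u * x u * poly g ((x u)\<^sup>2)) =
        a t * x t * poly g ((x t)\<^sup>2)" by simp
  qed
  finally have "a t * x t * poly g ((x t)\<^sup>2) = 0" .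
  moreover have "poly g ((x t)\<^sup>2) \<noteq> 0"
    using assms(1) inj t by (auto simp: g_def poly_prod inj_on_def)
  ultimately show ?thesis using nz[OF t] by simp
qed

text \<open>The left-hand side is the coefficient of degree \<open>m\<close> in Lagrange's interpolation formula for
  \<open>g\<close>.\<close>

lemma lagrange_top_coeff:
  fixes y :: "nat \<Rightarrow> 'a::field"
  assumes inj: "inj_on y {..m}" and deg: "degree g < m"
  shows "(\<Sum>t\<le>m. poly g (y t) / (\<Prod>u\<in>{..m} - {t}. y t - y u)) = 0"
proof -
  let ?D = "\<lambda>t. \<Prod>u\<in>{..m} - {t}. y t - y u"
  define L where "L t = (\<Prod>u\<in>{..m} - {t}. [:- y u, 1:])" for t
  define h where "h = (\<Sum>t\<le>m. smult (poly g (y t) / ?D t) (L t))"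
  have degL: "degree (L t) = m" if "t \<le> m" for t
    using that by (simp add: L_def degree_prod_eq_sum_degree)
  have leadL: "coeff (L t) m = 1" if "t \<le> m" for t
    using lead_coeff_prod[of "\<lambda>u. [:- y u, 1:]" "{..m} - {t}"] degL[OF that]
    by (simp add: L_def)
  have D: "?D t \<noteq> 0" if "t \<le> m" for t
    using that inj by (auto simp: inj_on_def)
  have "h = g"
  proof (rule poly_eqI_degree)
    fix z assume "z \<in> y ` {..m}"
    then obtain s where s: "s \<le> m" "z = y s" by auto
    have *: "poly (L t) (y s) = 0" if "t \<le> m" "t \<noteq> s" for t
      using that s(1) by (auto simp: L_def poly_prod)
    have "poly h z = (\<Sum>t\<le>m. if t = s then poly g (y s) / ?D s * poly (L s) (y s) else 0)"
      unfolding h_def s poly_sum by (intro sum.cong) (auto simp: *)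
    also have "\<dots> = poly g (y s) / ?D s * poly (L s) (y s)"
      using s by simp
    also have "poly (L s) (y s) = ?D s"
      by (simp add: L_def poly_prod)
    finally show "poly h z = poly g z" using D[OF s(1)] s by simp
  next
    have "degree h \<le> m"
      unfolding h_def by (intro degree_sum_le) (auto simp: degL intro: order_trans[OF degree_smult_le])
    then show "degree h < card (y ` {..m})" by (simp add: card_image[OF inj])
    show "degree g < card (y ` {..m})" using deg by (simp add: card_image[OF inj])
  qed
  then have "coeff h m = 0" using deg by (simp add: coeff_eq_0)
  then show ?thesis by (simp add: h_def coeff_sum leadL)
qed

text \<open>If \<open>x = - y\<close>, adding the two congruences shows that \<open>2 * n\<close>
  divides \<open>2 * c\<close>, contrary to the assumption on \<open>c\<close>; \<open>x = 0\<close>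
  is excluded similarly.\<close>

lemma squares_distinct:
  fixes x y c n :: int
  assumes c: "\<not> n dvd c" and x: "2 * n dvd x - c" and y: "2 * n dvd y - c"
  shows "x \<noteq> 0" and "x\<^sup>2 = y\<^sup>2 \<Longrightarrow> x = y"
proof -
  have *: "n dvd c" if "2 * n dvd 2 * c" using that by simp
  show "x \<noteq> 0"
  proof
    assume "x = 0"
    then have "2 * n dvd c" using x by simp
    then show False using c dvd_mult_right by blast
  qed
  assume "x\<^sup>2 = y\<^sup>2"
  then consider "x = y" | "x = - y" by (auto simp: power2_eq_iff)
  then show "x = y"
  proof cases
    case 2
    then have "2 * n dvd 2 * c" using dvd_add[OF x y] by (simp add: algebra_simps)
    with * c show ?thesis by simp
  qed
qed

text \<open>All these nodes are congruent to \<open>m * N + j\<close> modulo \<open>2 * N\<close>,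
  and \<open>N\<close> does not divide this number because \<open>0 < j < N\<close>.\<close>

lemma exponent_squares_distinct:
  fixes N m j :: nat
  assumes "j \<in> {1..<N}"
  defines "x \<equiv> (\<lambda>t. (int m - 2 * int t) * int N + int j)"
  shows "x t \<noteq> 0" and "(x t)\<^sup>2 = (x u)\<^sup>2 \<Longrightarrow> t = u"
proof -
  have "\<not> int N dvd int j" using assms by (simp add: nat_dvd_not_less)
  then have c: "\<not> int N dvd int m * int N + int j" by (simp add: dvd_add_right_iff)
  have d: "2 * int N dvd x t - (int m * int N + int j)" for t
    by (rule dvdI[of _ _ "- int t"]) (simp add: x_def algebra_simps)
  show "x t \<noteq> 0" using squares_distinct(1)[OF c d d] .
  assume "(x t)\<^sup>2 = (x u)\<^sup>2"
  then have "x t = x u" using squares_distinct(2)[OF c d d] by blast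
  then show "t = u" using assms by (simp add: x_def)
qed

lemma exponent_nodes:
  assumes "j \<in> {1..<N}"
  shows "inj_on (\<lambda>t. (of_int ((int m - 2 * int t) * int N + int j) :: complex)\<^sup>2) A"
    and "(of_int ((int m - 2 * int t) * int N + int j) :: complex) \<noteq> 0"
proof (rule inj_onI)
  fix t u
  assume "(of_int ((int m - 2 * int t) * int N + int j) :: complex)\<^sup>2 =
    (of_int ((int m - 2 * int u) * int N + int j))\<^sup>2"
  then show "t = u"
    unfolding of_int_power[symmetric] of_int_eq_iff by (rule exponent_squares_distinct(2)[OF assms])
next
  show "(of_int ((int m - 2 * int t) * int N + int j) :: complex) \<noteq> 0"
    unfolding of_int_eq_0_iff by (rule exponent_squares_distinct(1)[OF assms])
qed

lemma coeff_solution_exists: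
  assumes "j \<in> {1..<N}"
  shows "\<exists>a. coeff_solution N m j a"
proof -
  define x :: "nat \<Rightarrow> complex" where "x t = of_int ((int m - 2 * int t) * int N + int j)" for t
  \<comment> \<open>With these weights the moment of order \<open>2 * s - 1\<close> is the divided
    difference of the monomial of degree \<open>s - 1\<close> at the \<open>m + 1\<close> squared
    nodes, which is zero since \<open>s - 1 < m\<close>.\<close>
  define a where "a t = 1 / (x t * (\<Prod>u\<in>{..m} - {t}. (x t)\<^sup>2 - (x u)\<^sup>2))" for t
  have nz: "x t \<noteq> 0" for t
    unfolding x_def by (rule exponent_nodes(2)[OF assms])
  have inj: "inj_on (\<lambda>t. (x t)\<^sup>2) {..m}"
    unfolding x_def by (rule exponent_nodes(1)[OF assms])
  have "a 0 \<noteq> 0"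
    using nz inj by (auto simp: a_def inj_on_def)
  moreover have "(\<Sum>t\<le>m. of_int (((int m - 2 * int t) * int N + int j) ^ (2 * s - 1)) * a t) = 0"
    if s: "s \<in> {1..m}" for s
  proof -
    have "(\<Sum>t\<le>m. of_int (((int m - 2 * int t) * int N + int j) ^ (2 * s - 1)) * a t) =
      (\<Sum>t\<le>m. poly (monom 1 (s - 1)) ((x t)\<^sup>2) / (\<Prod>u\<in>{..m} - {t}. (x t)\<^sup>2 - (x u)\<^sup>2))"
    proof (rule sum.cong[OF refl])
      fix t
      have "2 * s - 1 = Suc (2 * (s - 1))" using s by auto
      then have "of_int (((int m - 2 * int t) * int N + int j) ^ (2 * s - 1)) = x t * ((x t)\<^sup>2) ^ (s - 1)"
        unfolding of_int_power x_def[symmetric] by (simp add: power_mult)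
      then show "of_int (((int m - 2 * int t) * int N + int j) ^ (2 * s - 1)) * a t =
        poly (monom 1 (s - 1)) ((x t)\<^sup>2) / (\<Prod>u\<in>{..m} - {t}. (x t)\<^sup>2 - (x u)\<^sup>2)"
        using nz[of t] by (simp add: a_def poly_monom)
    qed
    also have "\<dots> = 0"
      using s by (intro lagrange_top_coeff inj) (auto simp: degree_monom_eq)
    finally show ?thesis .
  qed
  ultimately show ?thesis
    unfolding coeff_solution_def by (intro exI[of _ a]) blast
qed

text \<open>If \<open>a 0\<close> vanished, the other \<open>m\<close> unknowns would satisfy a
  nonsingular Vandermonde system of \<open>m\<close> homogeneous equations. So the pure power of
  \<open>Z\<close> really occurs in the generator.\<close>

lemma coeff_solution_0_nonzero:
  assumes j: "j \<in> {1..<N}" and a: "coeff_solution N m j a"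
  shows "a 0 \<noteq> 0"
proof
  assume a0: "a 0 = 0"
  define x :: "nat \<Rightarrow> complex" where "x t = of_int ((int m - 2 * int t) * int N + int j)" for t
  have "a t = 0" if "t \<in> {1..m}" for t
  proof (rule odd_moments_zero[where I = "{1..m}" and x = x and m = m and a = a, OF _ _ _ _ _ that])
    show "inj_on (\<lambda>t. (x t)\<^sup>2) {1..m}"
      unfolding x_def by (rule exponent_nodes(1)[OF j])
    show "x t \<noteq> 0" for t
      unfolding x_def by (rule exponent_nodes(2)[OF j])
    fix s :: nat assume "odd s" "s < 2 * m"
    then obtain r where r: "s = 2 * r - 1" "r \<in> {1..m}" using odd_below_double by blast
    have "0 = (\<Sum>t\<le>m. x t ^ s * a t)"
      using a r unfolding coeff_solution_def x_def by simp
    also have "{..m} = insert 0 {1..m}" by auto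
    finally show "(\<Sum>t\<in>{1..m}. x t ^ s * a t) = 0" using a0 by simp
  qed auto
  moreover have "t \<in> {1..m}" if "t \<le> m" "t \<noteq> 0" for t using that by auto
  ultimately have "a t = 0" if "t \<le> m" for t using a0 that by metis
  then show False using a by (auto simp: coeff_solution_def)
qed

section \<open>Homogeneous components in the coordinates \<open>Z\<close> and
  \<open>Zbar\<close>\<close>

definition homog :: "nat \<Rightarrow> (nat \<Rightarrow> complex) \<Rightarrow> bipoly" where
  "homog d c = (\<Sum>a\<le>d. Const (c a) * Z ^ a * Zbar ^ (d - a))"

lemma homog_add: "homog d c + homog d e = homog d (\<lambda>a. c a + e a)"
  by (simp add: homog_def sum.distrib Const.add algebra_simps)

lemma homog_0: "homog d (\<lambda>_. 0) = 0"
  by (simp add: homog_def Const.zero)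

lemma homog_mono: "Const c * Z ^ a * Zbar ^ b = homog (a + b) (\<lambda>i. if i = a then c else 0)"
proof -
  have "homog (a + b) (\<lambda>i. if i = a then c else 0) =
    (\<Sum>i\<le>a + b. if i = a then Const c * Z ^ a * Zbar ^ b else 0)"
    unfolding homog_def by (intro sum.cong) (auto simp: Const.zero)
  then show ?thesis by simp
qed

lemma homog_mult_Z_Zbar:
  assumes "c 0 = 0" "c (Suc (Suc d)) = 0"
  shows "homog (Suc (Suc d)) c = Z * Zbar * homog d (\<lambda>a. c (Suc a))"
proof -
  have "homog (Suc (Suc d)) c = (\<Sum>a\<le>d. Const (c (Suc a)) * Z ^ Suc a * Zbar ^ (Suc d - a))"
    unfolding homog_def
    by (subst sum.atMost_Suc, subst sum.atMost_Suc_shift) (simp add: assms Const.zero)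
  also have "\<dots> = Z * Zbar * homog d (\<lambda>a. c (Suc a))"
    unfolding homog_def sum_distrib_left by (intro sum.cong) (auto simp: Suc_diff_le mult_ac)
  finally show ?thesis .
qed

definition is_homog :: "nat \<Rightarrow> bipoly \<Rightarrow> bool" where
  "is_homog d p \<longleftrightarrow> (\<exists>c. p = homog d c)"

lemma is_homog_0: "is_homog d 0"
  unfolding is_homog_def by (metis homog_0)

lemma is_homog_add: "is_homog d p \<Longrightarrow> is_homog d q \<Longrightarrow> is_homog d (p + q)"
  by (auto simp: is_homog_def homog_add)

lemma is_homog_sum: "(\<And>x. x \<in> A \<Longrightarrow> is_homog d (f x)) \<Longrightarrow> is_homog d (sum f A)"
  by (induction A rule: infinite_finite_induct) (auto simp: is_homog_0 is_homog_add)

lemma is_homog_mono: "a + b = d \<Longrightarrow> is_homog d (Const c * Z ^ a * Zbar ^ b)"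
  using homog_mono is_homog_def by metis

lemma is_homog_mult:
  assumes "is_homog d p" "is_homog d' q"
  shows "is_homog (d + d') (p * q)"
proof -
  obtain c e where *: "p = homog d c" "q = homog d' e" using assms by (auto simp: is_homog_def)
  have "is_homog (d + d') (Const (c a) * Z ^ a * Zbar ^ (d - a) * (Const (e b) * Z ^ b * Zbar ^ (d' - b)))"
    if "a \<le> d" "b \<le> d'" for a b
  proof -
    have "Const (c a) * Z ^ a * Zbar ^ (d - a) * (Const (e b) * Z ^ b * Zbar ^ (d' - b)) =
      Const (c a * e b) * Z ^ (a + b) * Zbar ^ (d - a + (d' - b))"
      by (simp add: Const.mult power_add mult_ac)
    then show ?thesis using is_homog_mono that by simp
  qed
  then show ?thesis
    unfolding * homog_def sum_product by (intro is_homog_sum) auto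
qed

lemma is_homog_Const: "is_homog 0 (Const c)"
  using is_homog_mono[of 0 0 0 c] by simp

lemma is_homog_power: "is_homog d p \<Longrightarrow> is_homog (d * n) (p ^ n)"
proof (induction n)
  case 0
  then show ?case using is_homog_Const[of 1] by (simp add: Const.one)
next
  case (Suc n)
  then show ?case using is_homog_mult[of d p "d * n" "p ^ n"] by simp
qed

lemma is_homog_Z_pow: "is_homog n (Z ^ n)" and is_homog_Zbar_pow: "is_homog n (Zbar ^ n)"
  using is_homog_mono[of n 0 n 1] is_homog_mono[of 0 n n 1] by (simp_all add: Const.one)

lemma is_homog_minus: "is_homog d p \<Longrightarrow> is_homog d (- p)"
  using is_homog_mult[OF is_homog_Const[of "-1"], of d p] by (simp add: Const.minus Const.one)

lemma is_homog_diff: "is_homog d p \<Longrightarrow> is_homog d q \<Longrightarrow> is_homog d (p - q)"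
  using is_homog_add[of d p "- q"] is_homog_minus by simp

lemma is_homog_q_poly: "is_homog (m * N + j) (q_poly N m j a)"
  unfolding q_poly_def
proof (intro is_homog_sum)
  fix t assume "t \<in> {..m}"
  then have "is_homog (m * N + j) (Const (a t) * Z ^ ((m - t) * N + j) * Zbar ^ (t * N))"
    by (intro is_homog_mono q_exponents) simp
  then show "is_homog (m * N + j) (Const (a t) * Zbar ^ (t * N) * Z ^ ((m - t) * N + j))"
    by (simp only: mult_ac)
qed

lemma is_homog_qbar_poly: "is_homog (m * N + j) (qbar_poly N m j a)"
  unfolding qbar_poly_def
proof (intro is_homog_sum)
  fix t assume "t \<in> {..m}"
  then show "is_homog (m * N + j) (Const (cnj (a t)) * Z ^ (t * N) * Zbar ^ ((m - t) * N + j))"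
    by (intro is_homog_mono) (use q_exponents(2)[of t m N j] in simp)
qed

lemma is_homog_q_last: "is_homog (N * (2 * m + 1)) (q_last N m)"
  unfolding q_last_def by (intro is_homog_power is_homog_diff is_homog_Z_pow is_homog_Zbar_pow)

text \<open>The bound is strict so that \<open>deg_below 0\<close> means being zero, which is where
  the descent in the independence proof ends.\<close>

definition deg_below :: "nat \<Rightarrow> bipoly \<Rightarrow> bool" where
  "deg_below n p \<longleftrightarrow> (\<exists>c. p = (\<Sum>d<n. homog d (c d)))"

lemma deg_below_mono:
  assumes "deg_below n p" "n \<le> n'"
  shows "deg_below n' p"
proof -
  obtain c where p: "p = (\<Sum>d<n. homog d (c d))" using assms(1) by (auto simp: deg_below_def)
  have "p = (\<Sum>d<n'. homog d (if d < n then c d else (\<lambda>_. 0)))"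
    unfolding p by (rule sum.mono_neutral_cong_left) (use assms(2) in \<open>auto simp: homog_0\<close>)
  then show ?thesis
    unfolding deg_below_def by (intro exI[of _ "\<lambda>d. if d < n then c d else (\<lambda>_. 0)"])
qed

lemma deg_below_add: "deg_below n p \<Longrightarrow> deg_below n q \<Longrightarrow> deg_below n (p + q)"
  by (fastforce simp: deg_below_def homog_add simp flip: sum.distrib)

lemma deg_below_homog: "deg_below (Suc d) (homog d c)"
  unfolding deg_below_def
  by (intro exI[of _ "\<lambda>i. if i = d then c else (\<lambda>_. 0)"]) (simp add: homog_0)

lemma deg_below_exists: "\<exists>n. deg_below n p"
proof (induction p rule: zz_induct)
  case (mono k a b)
  show ?case unfolding homog_mono using deg_below_homog by blast
next
  case (add p q)
  then obtain n n' where "deg_below n p" "deg_below n' q" by blast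
  then have "deg_below (max n n') p" "deg_below (max n n') q" by (auto intro: deg_below_mono)
  then show ?case using deg_below_add by blast
qed

section \<open>The discrete Fourier transform over the mirrors\<close>

lemma cis_root_of_unity_eq_1:
  assumes "N > 0"
  shows "cis (2 * pi * real_of_int z / real N) = 1 \<longleftrightarrow> int N dvd z"
proof
  assume "cis (2 * pi * real_of_int z / real N) = 1"
  then have "cos (2 * pi * real_of_int z / real N) = 1" by (simp add: complex_eq_iff)
  then obtain k :: int where "2 * pi * real_of_int z / real N = real_of_int k * 2 * pi"
    by (auto simp: cos_one_2pi_int)
  then have "real_of_int z = real_of_int (k * int N)" using assms by (simp add: field_simps)
  then show "int N dvd z" by (simp only: of_int_eq_iff) simp
next
  assume "int N dvd z"
  then obtain k where "z = int N * k" by blast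
  then have "2 * pi * real_of_int z / real N = 2 * pi * real_of_int k" using assms by simp
  then show "cis (2 * pi * real_of_int z / real N) = 1" by (simp add: cis_multiple_2pi)
qed

lemma root_of_unity_sum:
  assumes "N > 0"
  shows "(\<Sum>j<N. cis (2 * pi * real_of_int z / real N) ^ j) = (if int N dvd z then of_nat N else 0)"
proof -
  define w where "w = cis (2 * pi * real_of_int z / real N)"
  have "real N * (2 * pi * real_of_int z / real N) = 2 * pi * real_of_int z" using assms by simp
  then have wN: "w ^ N = 1"
    unfolding w_def Complex.DeMoivre by (simp add: cis_multiple_2pi)
  have "w = 1 \<longleftrightarrow> int N dvd z"
    unfolding w_def by (rule cis_root_of_unity_eq_1[OF assms])
  then show ?thesis
    using geometric_sum[of w N] wN by (auto simp flip: w_def)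
qed

text \<open>The quasiinvariance conditions on a homogeneous polynomial of degree \<open>d\<close>, separated
  by the residue class of the exponent of \<open>Z\<close> modulo \<open>N\<close>.\<close>

definition moment_conditions :: "nat \<Rightarrow> nat \<Rightarrow> nat \<Rightarrow> (nat \<Rightarrow> complex) \<Rightarrow> bool" where
  "moment_conditions N m d c \<longleftrightarrow> (\<forall>k s. odd s \<longrightarrow> s < 2 * m \<longrightarrow>
     (\<Sum>a\<le>d. if int N dvd int a - int k then of_int (2 * int a - int d) ^ s * c a else 0) = 0)"

text \<open>The monomial restricts to mirror \<open>j\<close> with factor \<open>eps N j\<close> to
  the power \<open>2 * a - d\<close>. The twist makes the exponent \<open>2 * (a - k)\<close>, which
  turns the factor into the \<open>j\<close>-th power of an \<open>N\<close>-th root of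
  unity.\<close>

lemma eps_power_mixed:
  assumes "a \<le> d"
  shows "eps N j ^ d * cnj (eps N j) ^ (2 * k) * (eps N j ^ a * cnj (eps N j) ^ (d - a)) =
    cis (2 * pi * real_of_int (int a - int k) / real N) ^ j"
proof -
  have "eps N j ^ d * cnj (eps N j) ^ (2 * k) * (eps N j ^ a * cnj (eps N j) ^ (d - a)) =
    eps N j ^ (2 * a) * (eps N j * cnj (eps N j)) ^ (d - a) * cnj (eps N j) ^ (2 * k)"
    using assms by (auto simp: power_mult_distrib mult_2 power_add dest!: le_Suc_ex)
  also have "\<dots> = eps N j ^ (2 * a) * cnj (eps N j ^ (2 * k))"
    by (simp add: eps_cnj)
  also have "\<dots> = cis (real (2 * a) * (pi * real j / real N) + - (real (2 * k) * (pi * real j / real N)))"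
    by (simp only: eps_def Complex.DeMoivre cis_cnj cis_mult)
  also have "real (2 * a) * (pi * real j / real N) + - (real (2 * k) * (pi * real j / real N)) =
    real j * (2 * pi * real_of_int (int a - int k) / real N)"
    by (simp add: algebra_simps diff_divide_distrib)
  finally show ?thesis by (simp only: Complex.DeMoivre)
qed

lemma moment_conditions_if_quasiinvariant:
  assumes N: "N > 0" and Q: "(\<Sum>d<n. homog d (c d)) \<in> quasiinvariants N m" and d: "d < n"
  shows "moment_conditions N m d (c d)"
  unfolding moment_conditions_def
proof (intro allI impI)
  fix k s :: nat assume s: "odd s" "s < 2 * m"
  \<comment> \<open>The coefficient of degree \<open>d\<close> in the restriction of the
    \<open>s\<close>-th angular derivative to mirror \<open>j\<close>. Distinct degrees separate, so
    it vanishes for each \<open>d < n\<close>.\<close>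
  define S where "S j d = (\<Sum>a\<le>d. c d a * (\<i> * (of_nat a - of_nat (d - a))) ^ s *
    (eps N j ^ a * cnj (eps N j) ^ (d - a)))" for j d
  have S0: "S j d = 0" if "j < N" for j
  proof -
    have "restr (root_vec N j) ((rotd ^^ s) (homog d (c d))) = monom (S j d) d" for d
      unfolding homog_def rotd_pow_sum restr.sum restr_rotd_pow_mono S_def monom_sum
      by (intro sum.cong) auto
    then have "restr (root_vec N j) ((rotd ^^ s) (\<Sum>d<n. homog d (c d))) = (\<Sum>d<n. monom (S j d) d)"
      unfolding rotd_pow_sum restr.sum by simp
    then have "(\<Sum>d<n. monom (S j d) d) = 0"
      using Q s that by (simp add: quasiinvariants_rotd)
    then have "coeff (\<Sum>d<n. monom (S j d) d) d = 0" by simp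
    then show ?thesis using d by (simp add: coeff_sum if_distrib cong: if_cong)
  qed
  let ?X = "\<lambda>a. of_int (2 * int a - int d) ^ s * c d a"
  \<comment> \<open>Summing over the mirrors with this twist retains exactly the exponents congruent
    to \<open>k\<close> modulo \<open>N\<close>.\<close>
  have "0 = (\<Sum>j<N. eps N j ^ d * cnj (eps N j) ^ (2 * k) * S j d)"
    using S0 by simp
  also have "\<dots> = (\<Sum>j<N. \<Sum>a\<le>d. \<i> ^ s * ?X a * cis (2 * pi * real_of_int (int a - int k) / real N) ^ j)"
  proof (intro sum.cong refl)
    fix j
    show "eps N j ^ d * cnj (eps N j) ^ (2 * k) * S j d =
      (\<Sum>a\<le>d. \<i> ^ s * ?X a * cis (2 * pi * real_of_int (int a - int k) / real N) ^ j)"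
      unfolding S_def sum_distrib_left
    proof (intro sum.cong refl)
      fix a assume "a \<in> {..d}"
      then have a: "a \<le> d" by simp
      then have x: "of_nat a - of_nat (d - a) = (of_int (2 * int a - int d) :: complex)"
        by (simp add: of_nat_diff)
      have "eps N j ^ d * cnj (eps N j) ^ (2 * k) * (c d a * (\<i> * (of_nat a - of_nat (d - a))) ^ s *
          (eps N j ^ a * cnj (eps N j) ^ (d - a))) =
        c d a * (\<i> * (of_nat a - of_nat (d - a))) ^ s * (eps N j ^ d * cnj (eps N j) ^ (2 * k) *
          (eps N j ^ a * cnj (eps N j) ^ (d - a)))"
        by (simp only: mult_ac)
      also have "\<dots> = \<i> ^ s * ?X a * cis (2 * pi * real_of_int (int a - int k) / real N) ^ j"
        unfolding eps_power_mixed[OF a] x power_mult_distrib by (simp only: mult_ac)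
      finally show "eps N j ^ d * cnj (eps N j) ^ (2 * k) * (c d a * (\<i> * (of_nat a - of_nat (d - a))) ^ s *
          (eps N j ^ a * cnj (eps N j) ^ (d - a))) =
        \<i> ^ s * ?X a * cis (2 * pi * real_of_int (int a - int k) / real N) ^ j" .
    qed
  qed
  also have "\<dots> = (\<Sum>a\<le>d. \<i> ^ s * ?X a * (if int N dvd int a - int k then of_nat N else 0))"
    unfolding root_of_unity_sum[OF N, symmetric] sum_distrib_left by (rule sum.swap)
  also have "\<dots> = \<i> ^ s * of_nat N * (\<Sum>a\<le>d. if int N dvd int a - int k then ?X a else 0)"
    unfolding sum_distrib_left by (intro sum.cong) auto
  finally show "(\<Sum>a\<le>d. if int N dvd int a - int k then ?X a else 0) = 0"
    using N by simp
qed

section \<open>Spanning\<close>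

lemma moment_conditions_diff:
  assumes "moment_conditions N m d c" "moment_conditions N m d e"
  shows "moment_conditions N m d (\<lambda>a. c a - e a)"
  unfolding moment_conditions_def
proof (intro allI impI)
  fix k s :: nat assume s: "odd s" "s < 2 * m"
  have "(\<Sum>a\<le>d. if int N dvd int a - int k then of_int (2 * int a - int d) ^ s * (c a - e a) else 0) =
    (\<Sum>a\<le>d. if int N dvd int a - int k then of_int (2 * int a - int d) ^ s * c a else 0) -
    (\<Sum>a\<le>d. if int N dvd int a - int k then of_int (2 * int a - int d) ^ s * e a else 0)"
    unfolding sum_subtractf[symmetric] by (intro sum.cong) (auto simp: right_diff_distrib)
  also have "\<dots> = 0"
    using assms s by (simp add: moment_conditions_def)
  finally show "(\<Sum>a\<le>d. if int N dvd int a - int k then of_int (2 * int a - int d) ^ s * (c a - e a) else 0) = 0" .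
qed

text \<open>Removing \<open>Z * Zbar\<close> lowers \<open>a\<close> by one and \<open>d\<close> by
  two, so the nodes \<open>2 * a - d\<close> are unchanged and the residue classes shift by
  one.\<close>

lemma moment_conditions_shift:
  assumes c: "moment_conditions N m (Suc (Suc d)) c" and 0: "c 0 = 0" "c (Suc (Suc d)) = 0"
  shows "moment_conditions N m d (\<lambda>a. c (Suc a))"
  unfolding moment_conditions_def
proof (intro allI impI)
  fix k s :: nat assume s: "odd s" "s < 2 * m"
  have "0 = (\<Sum>a\<le>Suc (Suc d). if int N dvd int a - int (Suc k)
      then of_int (2 * int a - int (Suc (Suc d))) ^ s * c a else 0)"
    using c[unfolded moment_conditions_def, rule_format, OF s, of "Suc k"] by (rule sym)
  also have "\<dots> = (\<Sum>a\<le>d. if int N dvd int (Suc a) - int (Suc k)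
      then of_int (2 * int (Suc a) - int (Suc (Suc d))) ^ s * c (Suc a) else 0)"
    by (subst sum.atMost_Suc, subst sum.atMost_Suc_shift) (simp add: 0)
  also have "\<dots> = (\<Sum>a\<le>d. if int N dvd int a - int k
      then of_int (2 * int a - int d) ^ s * c (Suc a) else 0)"
    by (intro sum.cong refl) (simp add: algebra_simps)
  finally show "(\<Sum>a\<le>d. if int N dvd int a - int k then of_int (2 * int a - int d) ^ s * c (Suc a) else 0) = 0" ..
qed

lemma card_residue_class_le:
  fixes N d k :: nat
  assumes "N > 0"
  shows "card {a \<in> {..d}. int N dvd int a - int k} \<le> Suc (d div N)"
proof -
  let ?I = "{a \<in> {..d}. int N dvd int a - int k}"
  have "inj_on (\<lambda>a. a div N) ?I"
  proof (rule inj_onI)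
    fix a b assume a: "a \<in> ?I" and b: "b \<in> ?I" and div: "a div N = b div N"
    have "int a mod int N = int b mod int N"
      using a b by (metis (mono_tags, lifting) mem_Collect_eq mod_eq_dvd_iff)
    then have "a mod N = b mod N" by (metis of_nat_eq_iff of_nat_mod)
    with div show "a = b" by (metis div_mult_mod_eq)
  qed
  moreover have "(\<lambda>a. a div N) ` ?I \<subseteq> {..d div N}" by (auto simp: div_le_mono)
  ultimately have "card ?I \<le> card {..d div N}" by (intro card_inj_on_le) auto
  then show ?thesis by simp
qed

text \<open>The residue class of \<open>a0\<close> contains at most \<open>m\<close> exponents, and
  by \<open>squares_distinct\<close> their nodes are nonzero with distinct squares. The equations
  for this class are therefore nonsingular.\<close>

lemma coeff_zero_if_low_degree:
  assumes c: "moment_conditions N m d c" and N: "N > 0" and low: "d div N < m"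
    and a0: "a0 \<le> d" "\<not> int N dvd 2 * int a0 - int d"
  shows "c a0 = 0"
proof (rule odd_moments_zero[where m = m and I = "{a \<in> {..d}. int N dvd int a - int a0}"
      and x = "\<lambda>a. of_int (2 * int a - int d)"])
  let ?I = "{a \<in> {..d}. int N dvd int a - int a0}"
  show "card ?I \<le> m" using card_residue_class_le[OF N, of d a0] low by simp
  have dvd: "2 * int N dvd (2 * int a - int d) - (2 * int a0 - int d)" if "a \<in> ?I" for a
  proof -
    have "2 * int N dvd 2 * (int a - int a0)" using that by (intro mult_dvd_mono) auto
    then show ?thesis by (simp add: algebra_simps)
  qed
  show "inj_on (\<lambda>a. (of_int (2 * int a - int d) :: complex)\<^sup>2) ?I"
  proof (rule inj_onI)
    fix a b assume a: "a \<in> ?I" and b: "b \<in> ?I"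
      and "(of_int (2 * int a - int d) :: complex)\<^sup>2 = (of_int (2 * int b - int d))\<^sup>2"
    then have "(2 * int a - int d)\<^sup>2 = (2 * int b - int d)\<^sup>2"
      unfolding of_int_power[symmetric] of_int_eq_iff by blast
    then show "a = b" using squares_distinct(2)[OF a0(2) dvd[OF a] dvd[OF b]] by simp
  qed
  show "(of_int (2 * int a - int d) :: complex) \<noteq> 0" if "a \<in> ?I" for a
    unfolding of_int_eq_0_iff using squares_distinct(1)[OF a0(2) dvd[OF that] dvd[OF that]] .
  show "(\<Sum>a\<in>?I. of_int (2 * int a - int d) ^ s * c a) = 0" if "odd s" "s < 2 * m" for s
    using c that unfolding moment_conditions_def
    by (subst sum.inter_filter) (auto simp del: of_int_diff of_int_mult)
qed (use a0 in auto)

text \<open>Here the exponents \<open>2 * a - d\<close> come in pairs of opposite sign, so only the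
  antisymmetric part of \<open>c\<close> is constrained.\<close>

lemma end_coeffs_eq_if_low_degree:
  assumes c: "moment_conditions N m d c" and N: "N > 0" and d: "d = N * n" and low: "n \<le> 2 * m"
  shows "c d = c 0"
proof (cases "d = 0")
  case False
  define A where "A = {a \<in> {..d}. N dvd a}"
  \<comment> \<open>One representative, the one with positive node, of each pair of exponents
    exchanged by \<open>a\<close> and \<open>d - a\<close>.\<close>
  define I where "I = {a \<in> A. d < 2 * a}"
  let ?x = "\<lambda>a. (of_int (2 * int a - int d) :: complex)"
  have [simp]: "finite A" "finite I" by (auto simp: A_def I_def)
  have "c d - c (d - d) = 0"
  proof (rule odd_moments_zero[where m = m and I = I and x = ?x and a = "\<lambda>a. c a - c (d - a)"])
    \<comment> \<open>At most half of the multiples, rounded up, lie in \<open>I\<close>; this is at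
      most \<open>m\<close> exactly because \<open>n\<close> is at most
      \<open>2 * m\<close>.\<close>
    have "I \<subseteq> (\<lambda>k. N * k) ` {n div 2 <.. n}"
    proof
      fix a assume "a \<in> I"
      then obtain k where "a = N * k" "d < 2 * a" "a \<le> d" by (auto simp: A_def I_def)
      then have "N * n < N * (2 * k)" "N * k \<le> N * n" by (auto simp: d)
      then have "n < 2 * k" "k \<le> n" using N by auto
      then show "a \<in> (\<lambda>k. N * k) ` {n div 2 <.. n}" using \<open>a = N * k\<close> by auto
    qed
    then have "card I \<le> card {n div 2 <.. n}" by (intro surj_card_le) auto
    then show "card I \<le> m" using low by simp
    show "inj_on (\<lambda>a. (?x a)\<^sup>2) I"
    proof (rule inj_onI)
      fix a b assume a: "a \<in> I" and b: "b \<in> I" and "(?x a)\<^sup>2 = (?x b)\<^sup>2"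
      then have "(2 * int a - int d)\<^sup>2 = (2 * int b - int d)\<^sup>2"
        unfolding of_int_power[symmetric] of_int_eq_iff by blast
      moreover have "2 * int a - int d > 0" "2 * int b - int d > 0"
        using a b by (auto simp: I_def)
      ultimately show "a = b" by (simp add: power2_eq_iff)
    qed
    show "?x a \<noteq> 0" if "a \<in> I" for a
      unfolding of_int_eq_0_iff using that by (auto simp: I_def)
    show "(\<Sum>a\<in>I. ?x a ^ s * (c a - c (d - a))) = 0" if s: "odd s" "s < 2 * m" for s
    proof -
      let ?f = "\<lambda>a. ?x a ^ s * c a"
      have "0 = (\<Sum>a\<le>d. if int N dvd int a - int 0 then ?f a else 0)"
        using c[unfolded moment_conditions_def, rule_format, OF s, of 0] by (rule sym)
      also have "\<dots> = sum ?f A"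
        unfolding A_def by (subst sum.inter_filter) auto
      \<comment> \<open>A middle exponent has node zero and drops out; on the mirrored half an odd
        power of the node changes sign, leaving the differences
        \<open>c a - c (d - a)\<close>.\<close>
      also have "A = I \<union> (\<lambda>a. d - a) ` I \<union> {a \<in> A. 2 * a = d}"
      proof (intro equalityI subsetI)
        fix a assume a: "a \<in> A"
        then have "a \<in> (\<lambda>a. d - a) ` I" if "2 * a < d"
          using that by (intro image_eqI[of _ _ "d - a"]) (auto simp: A_def I_def d intro: dvd_diff_nat)
        then show "a \<in> I \<union> (\<lambda>a. d - a) ` I \<union> {a \<in> A. 2 * a = d}"
          using a by (cases "2 * a" d rule: linorder_cases) (auto simp: I_def)
      qed (auto simp: A_def I_def d intro: dvd_diff_nat)
      also have "sum ?f \<dots> = sum ?f (I \<union> (\<lambda>a. d - a) ` I) + sum ?f {a \<in> A. 2 * a = d}"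
        by (rule sum.union_disjoint) (auto simp: I_def A_def)
      also have "sum ?f {a \<in> A. 2 * a = d} = 0"
        using s by (intro sum.neutral) (auto simp: odd_pos)
      also have "sum ?f (I \<union> (\<lambda>a. d - a) ` I) = sum ?f I + sum ?f ((\<lambda>a. d - a) ` I)"
        by (rule sum.union_disjoint) (auto simp: I_def A_def)
      also have "sum ?f ((\<lambda>a. d - a) ` I) = (\<Sum>a\<in>I. ?f (d - a))"
        by (subst sum.reindex) (auto simp: I_def A_def inj_on_def)
      also have "\<dots> = (\<Sum>a\<in>I. - (?x a ^ s * c (d - a)))"
      proof (intro sum.cong refl)
        fix a assume "a \<in> I"
        then have "?x (d - a) = - ?x a" by (auto simp: I_def A_def of_nat_diff)
        then show "?f (d - a) = - (?x a ^ s * c (d - a))"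
          using power_minus_odd[OF s(1), of "?x a"] by (simp only: mult_minus_left)
      qed
      finally show ?thesis
        by (simp add: right_diff_distrib sum_subtractf sum_negf)
    qed
    show "d \<in> I" using False by (auto simp: A_def I_def d)
  qed simp
  then show ?thesis by simp
qed simp

text \<open>Reduction modulo \<open>Zbar\<close>, with \<open>Z\<close> as the remaining variable:
  the two images solve \<open>Zbar = 0\<close>. On a form of degree \<open>d\<close> it reads off
  the coefficient of \<open>Z ^ d\<close>; \<open>mod_Z\<close> is its mirror image.\<close>

definition mod_Zbar :: "bipoly \<Rightarrow> complex poly" where
  "mod_Zbar = subst2 (\<lambda>c. [:c:]) [:0, 1 / 2:] [:0, - \<i> / 2:]"

definition mod_Z :: "bipoly \<Rightarrow> complex poly" where
  "mod_Z = subst2 (\<lambda>c. [:c:]) [:0, 1 / 2:] [:0, \<i> / 2:]"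

interpretation mod_Zbar: ring_map mod_Zbar
  unfolding mod_Zbar_def by (intro ring_map_subst2 ring_map_C)

interpretation mod_Z: ring_map mod_Z
  unfolding mod_Z_def by (intro ring_map_subst2 ring_map_C)

lemma mod_Zbar_simps: "mod_Zbar (Const c) = monom c 0" "mod_Zbar Z = monom 1 1" "mod_Zbar Zbar = 0"
  unfolding Z_def Zbar_def mod_Zbar.hom_simps
  by (simp_all add: mod_Zbar_def subst2_simps[OF ring_map_C] monom_0 monom_altdef)

lemma mod_Z_simps: "mod_Z (Const c) = monom c 0" "mod_Z Z = 0" "mod_Z Zbar = monom 1 1"
  unfolding Z_def Zbar_def mod_Z.hom_simps
  by (simp_all add: mod_Z_def subst2_simps[OF ring_map_C] monom_0 monom_altdef)

lemma mod_Zbar_homog: "mod_Zbar (homog d c) = monom (c d) d"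
proof -
  have "mod_Zbar (homog d c) = (\<Sum>a\<le>d. if a = d then monom (c d) d else 0)"
    unfolding homog_def mod_Zbar.sum
    by (intro sum.cong) (auto simp: mod_Zbar.hom_simps mod_Zbar_simps monom_power mult_monom zero_power)
  then show ?thesis by simp
qed

lemma mod_Z_homog: "mod_Z (homog d c) = monom (c 0) d"
proof -
  have "mod_Z (homog d c) = (\<Sum>a\<le>d. if a = 0 then monom (c 0) d else 0)"
    unfolding homog_def mod_Z.sum
    by (intro sum.cong) (auto simp: mod_Z.hom_simps mod_Z_simps monom_power mult_monom zero_power)
  then show ?thesis by simp
qed

text \<open>Modulo \<open>Zbar\<close> only the summand \<open>t = 0\<close> of
  \<open>q_poly\<close> survives, while every summand contains \<open>Z\<close> because
  \<open>j > 0\<close>. The conjugate generator behaves symmetrically.\<close>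

lemma mod_q_poly:
  assumes "N > 0" "j > 0"
  shows "mod_Zbar (q_poly N m j a) = monom (a 0) (m * N + j)" "mod_Z (q_poly N m j a) = 0"
    "mod_Zbar (qbar_poly N m j a) = 0" "mod_Z (qbar_poly N m j a) = monom (cnj (a 0)) (m * N + j)"
proof -
  have "mod_Zbar (q_poly N m j a) = (\<Sum>t\<le>m. if t = 0 then monom (a 0) (m * N + j) else 0)"
    unfolding q_poly_def mod_Zbar.sum using assms
    by (intro sum.cong) (auto simp: mod_Zbar.hom_simps mod_Zbar_simps monom_power mult_monom zero_power)
  then show "mod_Zbar (q_poly N m j a) = monom (a 0) (m * N + j)" by simp
  have "mod_Z (qbar_poly N m j a) = (\<Sum>t\<le>m. if t = 0 then monom (cnj (a 0)) (m * N + j) else 0)"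
    unfolding qbar_poly_def mod_Z.sum using assms
    by (intro sum.cong) (auto simp: mod_Z.hom_simps mod_Z_simps monom_power mult_monom zero_power)
  then show "mod_Z (qbar_poly N m j a) = monom (cnj (a 0)) (m * N + j)" by simp
  show "mod_Z (q_poly N m j a) = 0" "mod_Zbar (qbar_poly N m j a) = 0"
    using assms by (simp_all add: q_poly_def qbar_poly_def mod_Z.hom_simps mod_Z_simps
        mod_Zbar.hom_simps mod_Zbar_simps zero_power)
qed

lemma mod_q_last:
  assumes "N > 0"
  shows "mod_Zbar (q_last N m) = monom 1 (N * (2 * m + 1))" "mod_Z (q_last N m) = - monom 1 (N * (2 * m + 1))"
  using assms by (simp_all add: q_last_def mod_Z.hom_simps mod_Z_simps mod_Zbar.hom_simps mod_Zbar_simps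
      zero_power monom_power mult_monom minus_monom)

lemma mod_power_sum:
  assumes "N > 0"
  shows "mod_Zbar ((Z ^ N + Zbar ^ N) ^ n) = monom 1 (N * n)" "mod_Z ((Z ^ N + Zbar ^ N) ^ n) = monom 1 (N * n)"
  using assms by (simp_all add: mod_Z.hom_simps mod_Z_simps mod_Zbar.hom_simps mod_Zbar_simps zero_power monom_power)

section \<open>Spans over the invariants and matching of the end coefficients\<close>

definition inv_span :: "nat \<Rightarrow> bipoly list \<Rightarrow> bipoly set" where
  "inv_span N bs = {x. \<exists>c. (\<forall>i<length bs. c i \<in> invariants N) \<and> x = (\<Sum>i<length bs. c i * bs ! i)}"

lemma inv_span_0: "0 \<in> inv_span N bs"
  unfolding inv_span_def mem_Collect_eq by (intro exI[of _ "\<lambda>_. 0"]) (simp add: invariants_0)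

lemma inv_span_add:
  assumes "p \<in> inv_span N bs" "q \<in> inv_span N bs"
  shows "p + q \<in> inv_span N bs"
proof -
  obtain c e where "\<forall>i<length bs. c i \<in> invariants N" "p = (\<Sum>i<length bs. c i * bs ! i)"
    "\<forall>i<length bs. e i \<in> invariants N" "q = (\<Sum>i<length bs. e i * bs ! i)"
    using assms by (auto simp: inv_span_def)
  then show ?thesis
    unfolding inv_span_def mem_Collect_eq
    by (intro exI[of _ "\<lambda>i. c i + e i"]) (simp add: invariants_add distrib_right sum.distrib)
qed

lemma inv_span_sum: "(\<And>x. x \<in> A \<Longrightarrow> f x \<in> inv_span N bs) \<Longrightarrow> sum f A \<in> inv_span N bs"
  by (induction A rule: infinite_finite_induct) (auto simp: inv_span_0 inv_span_add)

lemma inv_span_mult: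
  assumes "p \<in> inv_span N bs" "r \<in> invariants N"
  shows "r * p \<in> inv_span N bs"
proof -
  obtain c where "\<forall>i<length bs. c i \<in> invariants N" "p = (\<Sum>i<length bs. c i * bs ! i)"
    using assms by (auto simp: inv_span_def)
  then show ?thesis
    unfolding inv_span_def mem_Collect_eq using assms(2)
    by (intro exI[of _ "\<lambda>i. r * c i"]) (simp add: invariants_mult sum_distrib_left mult.assoc)
qed

lemma inv_span_base:
  assumes "b \<in> set bs"
  shows "b \<in> inv_span N bs"
proof -
  obtain k where k: "k < length bs" "b = bs ! k" using assms by (auto simp: in_set_conv_nth)
  have "b = (\<Sum>i<length bs. (if i = k then 1 else 0) * bs ! i)"
    using k by (simp add: if_distrib[of "\<lambda>x. x * _"] cong: if_cong)
  then show ?thesis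
    unfolding inv_span_def mem_Collect_eq
    by (intro exI[of _ "\<lambda>i. if i = k then 1 else 0"]) (auto simp: invariants_0 invariants_1)
qed

lemma quasiinvariants_mult_invariant:
  "r \<in> invariants N \<Longrightarrow> q \<in> quasiinvariants N m \<Longrightarrow> r * q \<in> quasiinvariants N m"
  using is_subring_quasiinvariants invariants_subset_quasiinvariants unfolding is_subring_def by blast

lemma quasiinvariants_add:
  "p \<in> quasiinvariants N m \<Longrightarrow> q \<in> quasiinvariants N m \<Longrightarrow> p + q \<in> quasiinvariants N m"
  using is_subring_quasiinvariants unfolding is_subring_def by blast

lemma set_q_family: "set (q_family N m a) =
  {1, q_last N m} \<union> (\<lambda>j. q_poly N m j (a j)) ` {1..<N} \<union> (\<lambda>j. qbar_poly N m j (a j)) ` {1..<N}"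
  by (auto simp: q_family_def)

lemma q_family_subset:
  assumes "N > 0" "\<forall>j\<in>{1..<N}. coeff_solution N m j (a j)"
  shows "set (q_family N m a) \<subseteq> quasiinvariants N m"
  unfolding set_q_family
  using assms q_poly_quasiinvariant qbar_poly_quasiinvariant q_last_quasiinvariant
    is_subring_quasiinvariants[of N m] by (auto simp: is_subring_def)

text \<open>Four cases. If \<open>N\<close> divides \<open>d\<close>, the end coefficients agree up
  to degree \<open>2 * m * N\<close> and a power of \<sigma>_2 suffices; above that
  \<open>q_last\<close> corrects the difference. Otherwise both ends vanish when
  \<open>d div N < m\<close>, and from then on the two generators with \<open>j = d mod N\<close>
  adjust them separately.\<close>

lemma matching_end_coeffs:
  assumes N: "N \<ge> 2" and a: "\<forall>j\<in>{1..<N}. coeff_solution N m j (a j)"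
    and c: "moment_conditions N m d c"
  shows "\<exists>g. g \<in> inv_span N (q_family N m a) \<and> g \<in> quasiinvariants N m \<and> is_homog d g \<and>
    mod_Zbar g = monom (c d) d \<and> mod_Z g = monom (c 0) d"
proof -
  let ?bs = "q_family N m a" and ?\<sigma> = "Z ^ N + Zbar ^ N"
  have N0: "N > 0" using N by simp
  have Q: "b \<in> quasiinvariants N m" if "b \<in> set ?bs" for b
    using q_family_subset[OF N0 a] that by blast
  define n where "n = d div N"
  have \<sigma>: "is_homog (N * n) (?\<sigma> ^ n)" for n
    by (intro is_homog_power is_homog_add is_homog_Z_pow is_homog_Zbar_pow)
  have term_homog: "is_homog d (Const x * ?\<sigma> ^ k * b)" if "is_homog e b" "d = N * k + e" for x k b e
    using is_homog_mult[OF is_homog_mult[OF is_homog_Const \<sigma>] that(1)] that(2) by simp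
  have coef: "Const x * ?\<sigma> ^ k \<in> invariants N" for x k
    by (intro invariants_mult invariants_Const invariants_power invariants_power_sum N0)
  have term_span: "Const x * ?\<sigma> ^ k * b \<in> inv_span N ?bs" if "b \<in> set ?bs" for x k b
    by (intro inv_span_mult coef inv_span_base that)
  have term_Q: "Const x * ?\<sigma> ^ k * b \<in> quasiinvariants N m" if "b \<in> set ?bs" for x k b
    by (intro quasiinvariants_mult_invariant coef Q that)
  have bar: "mod_Zbar (Const x * ?\<sigma> ^ k * b) = monom (x * y) d" if "mod_Zbar b = monom y e" "d = N * k + e"
    for x y k b e
    unfolding mod_Zbar.mult mod_power_sum(1)[OF N0] mod_Zbar_simps(1) that by (simp add: mult_monom)
  have hol: "mod_Z (Const x * ?\<sigma> ^ k * b) = monom (x * y) d" if "mod_Z b = monom y e" "d = N * k + e"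
    for x y k b e
    unfolding mod_Z.mult mod_power_sum(2)[OF N0] mod_Z_simps(1) that by (simp add: mult_monom)
  \<comment> \<open>Every nonzero choice of \<open>g\<close> below is a combination of two
    generators times powers of \<sigma>_2, so a case amounts to solving two linear equations for
    \<open>x\<close> and \<open>x'\<close>.\<close>
  have two: ?thesis
    if b: "b \<in> set ?bs" "is_homog e b" "d = N * k + e" "mod_Zbar b = monom y e" "mod_Z b = monom z e"
      and b': "b' \<in> set ?bs" "is_homog e' b'" "d = N * k' + e'" "mod_Zbar b' = monom y' e'" "mod_Z b' = monom z' e'"
      and x: "x * y + x' * y' = c d" "x * z + x' * z' = c 0"
    for b b' k k' e e' x x' y y' z z'
  proof (intro exI[of _ "Const x * ?\<sigma> ^ k * b + Const x' * ?\<sigma> ^ k' * b'"] conjI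
        inv_span_add quasiinvariants_add is_homog_add term_span term_Q)
    show "is_homog d (Const x * ?\<sigma> ^ k * b)" "is_homog d (Const x' * ?\<sigma> ^ k' * b')"
      by (rule term_homog[OF b(2,3)], rule term_homog[OF b'(2,3)])
    show "mod_Zbar (Const x * ?\<sigma> ^ k * b + Const x' * ?\<sigma> ^ k' * b') = monom (c d) d"
      unfolding mod_Zbar.add bar[OF b(4,3)] bar[OF b'(4,3)] add_monom x ..
    show "mod_Z (Const x * ?\<sigma> ^ k * b + Const x' * ?\<sigma> ^ k' * b') = monom (c 0) d"
      unfolding mod_Z.add hol[OF b(5,3)] hol[OF b'(5,3)] add_monom x ..
  qed (use b b' in auto)
  have in_bs: "1 \<in> set ?bs" "q_last N m \<in> set ?bs" by (simp_all add: set_q_family)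
  have one: "is_homog 0 1" "mod_Zbar 1 = monom 1 0" "mod_Z 1 = monom 1 0"
    using is_homog_Const[of 1] by (simp_all add: Const.one mod_Zbar.one mod_Z.one monom_eq_1)
  show ?thesis
  proof (cases "N dvd d")
    case True
    then have d: "d = N * n" by (simp add: n_def)
    then have dn: "d = N * n + 0" by simp
    note one' = in_bs(1) one(1) dn one(2,3)
    show ?thesis
    proof (cases "n \<le> 2 * m")
      case True
      then have "c d = c 0" using end_coeffs_eq_if_low_degree[OF c N0 d] by blast
      then show ?thesis
        by (intro two[OF one' one', where x = "c d" and x' = 0]) auto
    next
      case False
      then have "n = n - (2 * m + 1) + (2 * m + 1)" by simp
      then have d': "d = N * (n - (2 * m + 1)) + N * (2 * m + 1)"
        unfolding d by (metis distrib_left)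
      have last: "mod_Z (q_last N m) = monom (-1) (N * (2 * m + 1))"
        unfolding mod_q_last(2)[OF N0] minus_monom ..
      \<comment> \<open>A power of \<sigma>_2 has end coefficients 1 and 1, the
        \<open>q_last\<close> term 1 and -1; hence the half sum and the half difference.\<close>
      show ?thesis
        by (intro two[OF one' in_bs(2) is_homog_q_last d' mod_q_last(1)[OF N0] last,
              where x = "(c d + c 0) / 2" and x' = "(c d - c 0) / 2"])
          (simp_all add: field_simps)
    qed
  next
    case False
    define j where "j = d mod N"
    have j: "j \<in> {1..<N}" using False N0 by (auto simp: j_def mod_greater_zero_iff_not_dvd Suc_le_eq)
    have d: "d = N * n + j" by (simp add: n_def j_def)
    show ?thesis
    proof (cases "n < m")
      case True
      have "\<not> int N dvd int d" using False by simp
      then have 0: "c d = 0" "c 0 = 0"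
        using True coeff_zero_if_low_degree[OF c N0] by (simp_all add: n_def)
      show ?thesis
        unfolding 0 using is_homog_0 inv_span_0 is_subring_quasiinvariants[of N m]
        by (intro exI[of _ 0]) (simp add: is_subring_def mod_Z.zero mod_Zbar.zero)
    next
      case False
      then have "n = n - m + m" by simp
      then have d': "d = N * (n - m) + (m * N + j)"
        unfolding d by (metis add.assoc distrib_left mult.commute)
      have nz: "a j 0 \<noteq> 0" using coeff_solution_0_nonzero[OF j] a j by blast
      have in_bs': "q_poly N m j (a j) \<in> set ?bs" "qbar_poly N m j (a j) \<in> set ?bs"
        using j by (simp_all add: set_q_family)
      have j0: "j > 0" using j by simp
      have z: "mod_Z (q_poly N m j (a j)) = monom 0 (m * N + j)"
        "mod_Zbar (qbar_poly N m j (a j)) = monom 0 (m * N + j)"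
        using mod_q_poly[OF N0 j0] by simp_all
      show ?thesis
        by (intro two[OF in_bs'(1) is_homog_q_poly d' mod_q_poly(1)[OF N0 j0] z(1)
              in_bs'(2) is_homog_qbar_poly d' z(2) mod_q_poly(4)[OF N0 j0],
              where x = "c d / a j 0" and x' = "c 0 / cnj (a j 0)"])
          (simp_all add: nz)
    qed
  qed
qed

lemma homog_in_span:
  assumes N: "N \<ge> 2" and a: "\<forall>j\<in>{1..<N}. coeff_solution N m j (a j)"
    and c: "moment_conditions N m d c"
  shows "homog d c \<in> inv_span N (q_family N m a)"
  using c
proof (induction d arbitrary: c rule: less_induct)
  case (less d)
  obtain g where g: "g \<in> inv_span N (q_family N m a)" "g \<in> quasiinvariants N m" "is_homog d g"
    "mod_Zbar g = monom (c d) d" "mod_Z g = monom (c 0) d"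
    using matching_end_coeffs[OF N a less.prems] by blast
  then obtain e where e: "g = homog d e" by (auto simp: is_homog_def)
  \<comment> \<open>The Fourier argument expects a sum of graded components, so \<open>g\<close> is
    written as one with a single nonzero component.\<close>
  have "(\<Sum>i<Suc d. homog i (if i = d then e else (\<lambda>_. 0))) = g"
    by (simp add: homog_0 e)
  then have "moment_conditions N m d e"
    using moment_conditions_if_quasiinvariant[where n = "Suc d" and d = d and m = m and N = N and
        c = "\<lambda>i. if i = d then e else (\<lambda>_. 0)"] N g(2)
    by simp
  from moment_conditions_diff[OF less.prems this]
  have mc: "moment_conditions N m d (\<lambda>a. c a - e a)" .
  have e0: "e d = c d" "e 0 = c 0"
    using g(4,5) unfolding e mod_Zbar_homog mod_Z_homog by (simp_all add: monom_eq_iff)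
  have diff: "homog d (\<lambda>a. c a - e a) \<in> inv_span N (q_family N m a)"
  \<comment> \<open>In degrees 0 and 1 every monomial is a pure power, so the difference is already
    zero.\<close>
  proof (cases "d < 2")
    case True
    then have "d = 0 \<or> d = 1" by auto
    then have "homog d (\<lambda>a. c a - e a) = 0" using e0 by (auto simp: homog_def Const.zero)
    then show ?thesis by (simp add: inv_span_0)
  next
    case False
    then obtain k where k: "d = Suc (Suc k)" by (metis add_2_eq_Suc le_Suc_ex not_less)
    have "homog d (\<lambda>a. c a - e a) = Z * Zbar * homog k (\<lambda>a. c (Suc a) - e (Suc a))"
      unfolding k by (rule homog_mult_Z_Zbar) (use e0 k in auto)
    moreover have "moment_conditions N m k (\<lambda>a. c (Suc a) - e (Suc a))"
      using moment_conditions_shift[OF mc[unfolded k]] e0 k by simp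
    then have "homog k (\<lambda>a. c (Suc a) - e (Suc a)) \<in> inv_span N (q_family N m a)"
      using less.IH[of k] k by simp
    ultimately show ?thesis using inv_span_mult invariants_norm by simp
  qed
  have "homog d c = g + homog d (\<lambda>a. c a - e a)"
    unfolding e homog_add by simp
  then show ?case using inv_span_add[OF g(1) diff] by simp
qed

lemma quasiinvariants_in_span:
  assumes N: "N \<ge> 2" and a: "\<forall>j\<in>{1..<N}. coeff_solution N m j (a j)"
    and q: "q \<in> quasiinvariants N m"
  shows "q \<in> inv_span N (q_family N m a)"
proof -
  obtain n c where "q = (\<Sum>d<n. homog d (c d))"
    using deg_below_exists[of q] by (auto simp: deg_below_def)
  then show ?thesis
    using moment_conditions_if_quasiinvariant[where n = n and c = c and N = N and m = m] N q
    by (auto intro!: inv_span_sum homog_in_span[OF N a])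
qed

section \<open>Linear independence\<close>

lemma eps_root_of_unity: "N > 0 \<Longrightarrow> eps N 1 ^ (2 * k) = 1 \<longleftrightarrow> N dvd k"
proof -
  assume N: "N > 0"
  have "real (2 * k) * (pi * real 1 / real N) = 2 * pi * real_of_int (int k) / real N" by simp
  then have "eps N 1 ^ (2 * k) = cis (2 * pi * real_of_int (int k) / real N)"
    by (simp only: eps_def Complex.DeMoivre)
  then show ?thesis using cis_root_of_unity_eq_1[OF N, of "int k"] by simp
qed

text \<open>A reflection exchanges \<open>Z\<close> and \<open>Zbar\<close> up to scalars and so
  exchanges the two reductions. For an invariant, mirror 0 shows that they coincide; mirror 1 then
  constrains their exponents.\<close>

lemma coeff_mod_Zbar_refl_map:
  "coeff (mod_Zbar (refl_map (root_vec N j) p)) k = cnj (eps N j) ^ (2 * k) * coeff (mod_Z p) k"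
proof (induction p rule: zz_induct)
  case (mono c a b)
  show ?case
    by (cases a) (auto simp: refl_map.hom_simps refl_map_simps refl_map_root mod_Zbar.hom_simps mod_Zbar_simps
        mod_Z.hom_simps mod_Z_simps monom_power mult_monom zero_power power_mult power_mult_distrib)
next
  case (add p q)
  then show ?case
    by (simp add: refl_map.hom_simps mod_Zbar.hom_simps mod_Z.hom_simps distrib_left)
qed

lemma mod_Z_invariant:
  assumes "N > 0" "p \<in> invariants N"
  shows "mod_Z p = mod_Zbar p"
proof (rule poly_eqI)
  fix k
  have "refl_map (root_vec N 0) p = p" using assms by (simp add: invariants_iff)
  moreover have "eps N 0 = 1" by (simp add: eps_def)
  ultimately show "coeff (mod_Z p) k = coeff (mod_Zbar p) k"
    using coeff_mod_Zbar_refl_map[of N 0 p k] by simp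
qed

definition supported_on_multiples :: "nat \<Rightarrow> 'a::comm_ring_1 poly \<Rightarrow> bool" where
  "supported_on_multiples N p \<longleftrightarrow> (\<forall>k. coeff p k \<noteq> 0 \<longrightarrow> N dvd k)"

text \<open>Comparing the reductions through mirror 1 multiplies the coefficient of degree
  \<open>k\<close> by \<open>cnj (eps N 1) ^ (2 * k)\<close>, and the square of
  \<open>eps N 1\<close> is a primitive \<open>N\<close>-th root of unity.\<close>

lemma supported_mod_Zbar:
  assumes "N \<ge> 2" "p \<in> invariants N"
  shows "supported_on_multiples N (mod_Zbar p)"
  unfolding supported_on_multiples_def
proof (intro allI impI)
  fix k assume k: "coeff (mod_Zbar p) k \<noteq> 0"
  have "refl_map (root_vec N 1) p = p" using assms by (simp add: invariants_iff)
  then have "coeff (mod_Zbar p) k = cnj (eps N 1) ^ (2 * k) * coeff (mod_Zbar p) k"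
    using coeff_mod_Zbar_refl_map[of N 1 p k] mod_Z_invariant[of N p] assms by simp
  then have "cnj (eps N 1 ^ (2 * k)) = 1" using k by simp
  then have "eps N 1 ^ (2 * k) = 1" by (metis complex_cnj_cnj complex_cnj_one)
  then show "N dvd k" using eps_root_of_unity[of N k] assms by simp
qed

lemma supported_add:
  "supported_on_multiples N p \<Longrightarrow> supported_on_multiples N q \<Longrightarrow> supported_on_multiples N (p + q)"
  unfolding supported_on_multiples_def by (metis add.right_neutral coeff_add)

lemma supported_mult_monom:
  assumes "supported_on_multiples N p" "N dvd n"
  shows "supported_on_multiples N (monom c n * p)"
  unfolding supported_on_multiples_def
proof (intro allI impI)
  fix k assume "coeff (monom c n * p) k \<noteq> 0"
  then have "n \<le> k" "coeff p (k - n) \<noteq> 0" by (auto simp: coeff_monom_mult split: if_splits)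
  then have "N dvd (k - n) + n"
    using dvd_add[of N "k - n" n] assms unfolding supported_on_multiples_def by blast
  then show "N dvd k" using \<open>n \<le> k\<close> by simp
qed

text \<open>The summands occupy different residue classes of exponents modulo \<open>N\<close>:
  \<open>g\<close> the class of 0, the \<open>j\<close>-th one the class of \<open>j\<close>.
  Nothing can cancel between them.\<close>

lemma residues_independent:
  fixes f :: "nat \<Rightarrow> 'a::idom poly"
  assumes g: "supported_on_multiples N g"
    and f: "\<And>j. j \<in> {1..<N} \<Longrightarrow> supported_on_multiples N (f j)"
    and b: "\<And>j. j \<in> {1..<N} \<Longrightarrow> b j \<noteq> 0"
    and sum: "g + (\<Sum>j\<in>{1..<N}. monom (b j) (m * N + j) * f j) = 0"
  shows "g = 0" and "\<And>j. j \<in> {1..<N} \<Longrightarrow> f j = 0"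
proof -
  show f0: "f j = 0" if j: "j \<in> {1..<N}" for j
  proof (rule poly_eqI)
    fix k
    show "coeff (f j) k = coeff 0 k"
    proof (cases "N dvd k")
      case False
      then show ?thesis using f[OF j] by (auto simp: supported_on_multiples_def)
    next
      case True
      \<comment> \<open>The position to which the \<open>j\<close>-th summand moves the coefficient
        of degree \<open>k\<close>.\<close>
      let ?K = "k + (m * N + j)"
      have "\<not> N dvd ?K"
        using True j by (simp add: dvd_add_right_iff nat_dvd_not_less)
      then have "coeff g ?K = 0" using g by (auto simp: supported_on_multiples_def)
      moreover have "coeff (monom (b i) (m * N + i) * f i) ?K = 0" if i: "i \<in> {1..<N} - {j}" for i
      proof (cases "m * N + i \<le> ?K")
        case le: True
        have "\<not> N dvd ?K - (m * N + i)"
        proof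
          assume "N dvd ?K - (m * N + i)"
          then have "int N dvd int (?K - (m * N + i))" by (simp only: int_dvd_int_iff)
          then have "int N dvd int k + (int j - int i)"
            using le by (simp add: of_nat_diff algebra_simps)
          then have "int N dvd int j - int i"
            using True by (simp add: dvd_add_right_iff)
          then have "int j mod int N = int i mod int N" by (simp add: mod_eq_dvd_iff)
          then show False using i j by simp
        qed
        then show ?thesis
          using f[of i] i by (auto simp: coeff_monom_mult supported_on_multiples_def)
      qed (simp add: coeff_monom_mult)
      then have "coeff (\<Sum>i\<in>{1..<N}. monom (b i) (m * N + i) * f i) ?K =
          coeff (monom (b j) (m * N + j) * f j) ?K"
        unfolding coeff_sum using j by (subst sum.remove[of _ j]) auto
      moreover have "coeff g ?K + coeff (\<Sum>i\<in>{1..<N}. monom (b i) (m * N + i) * f i) ?K = 0"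
        unfolding coeff_add[symmetric] sum by simp
      ultimately have "b j * coeff (f j) k = 0" by (simp add: coeff_monom_mult)
      then show ?thesis using b[OF j] by simp
    qed
  qed
  show "g = 0" using sum f0 by simp
qed

section \<open>Division by \<sigma>_1\<close>

lemma Z_nonzero: "Z \<noteq> 0" and Zbar_nonzero: "Zbar \<noteq> 0"
  using mod_Zbar_simps(2) mod_Z_simps(3) mod_Zbar.zero mod_Z.zero by (metis monom_eq_0_iff one_neq_zero)+

lemma coeff_sum_monom: "d < n \<Longrightarrow> coeff (\<Sum>i<n. monom (f i) i) d = f d"
  by (simp add: coeff_sum if_distrib cong: if_cong)

text \<open>The two reductions exhibit the end coefficients of all graded components, so each
  component is divisible. The degree falls by two; recording a fall by one is enough for the
  descent.\<close>

lemma divide_Z_Zbar: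
  assumes p: "deg_below (Suc n) p" and "mod_Zbar p = 0" "mod_Z p = 0"
  shows "\<exists>q. deg_below n q \<and> p = Z * Zbar * q"
proof -
  obtain c where c: "p = (\<Sum>d<Suc n. homog d (c d))" using p by (auto simp: deg_below_def)
  have "(\<Sum>d<Suc n. monom (c d d) d) = 0" "(\<Sum>d<Suc n. monom (c d 0) d) = 0"
    using assms(2,3) unfolding c mod_Zbar.sum mod_Z.sum mod_Zbar_homog mod_Z_homog .
  then have ends: "c d d = 0" "c d 0 = 0" if "d < Suc n" for d
    using that coeff_sum_monom[of d "Suc n" "\<lambda>d. c d d"] coeff_sum_monom[of d "Suc n" "\<lambda>d. c d 0"]
    by simp_all
  have deg0: "deg_below n 0" unfolding deg_below_def
    by (intro exI[of _ "\<lambda>_ _. 0"]) (simp add: homog_0)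
  have "\<exists>r. deg_below n r \<and> homog d (c d) = Z * Zbar * r" if d: "d < Suc n" for d
  proof (cases "d < 2")
    case True
    then have "d = 0 \<or> d = 1" by auto
    then have "homog d (c d) = 0" using ends[OF d] by (auto simp: homog_def Const.zero)
    then show ?thesis using deg0 by (intro exI[of _ 0]) simp
  next
    case False
    then obtain k where k: "d = Suc (Suc k)" by (metis add_2_eq_Suc le_Suc_ex not_less)
    have "homog d (c d) = Z * Zbar * homog k (\<lambda>a. c d (Suc a))"
      unfolding k by (rule homog_mult_Z_Zbar) (use ends[OF d] k in auto)
    moreover have "deg_below n (homog k (\<lambda>a. c d (Suc a)))"
      using deg_below_mono[OF deg_below_homog] d k by simp
    ultimately show ?thesis by blast
  qed
  then obtain r where r: "\<And>d. d < Suc n \<Longrightarrow> deg_below n (r d) \<and> homog d (c d) = Z * Zbar * r d"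
    by metis
  have "deg_below n (sum r A)" if "A \<subseteq> {..<Suc n}" for A
    using finite_subset[OF that finite_lessThan] that
    by (induction A rule: finite_induct) (auto simp: deg0 r intro: deg_below_add)
  moreover have "p = Z * Zbar * sum r {..<Suc n}"
    unfolding c sum_distrib_left using r by (intro sum.cong) auto
  ultimately show ?thesis by blast
qed

lemma invariants_cancel_norm:
  assumes "Z * Zbar * q \<in> invariants N"
  shows "q \<in> invariants N"
  unfolding invariants_iff
proof (intro allI impI)
  fix j assume "j < N"
  then have "refl_map (root_vec N j) (Z * Zbar) = Z * Zbar"
    "refl_map (root_vec N j) (Z * Zbar * q) = Z * Zbar * q"
    using assms invariants_norm[of N] by (auto simp: invariants_iff)
  then have "Z * Zbar * refl_map (root_vec N j) q = Z * Zbar * q"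
    by (simp only: refl_map.mult)
  then show "refl_map (root_vec N j) q = q"
    using Z_nonzero Zbar_nonzero by simp
qed

section \<open>Relations among the members of the family\<close>

lemma sum_nth_append:
  "(\<Sum>i<length (xs @ ys). f i * (xs @ ys) ! i) =
    (\<Sum>i<length xs. f i * xs ! i) + (\<Sum>i<length ys. f (length xs + i) * ys ! i)"
  for f :: "nat \<Rightarrow> 'a::semiring_0"
proof (induction ys rule: rev_induct)
  case (snoc y ys)
  then show ?case
    by (simp add: nth_append add.assoc[symmetric] flip: append_assoc)
qed (simp add: nth_append)

lemma sum_nth_map_upt:
  "(\<Sum>i<length (map g [1..<N]). f i * map g [1..<N] ! i) = (\<Sum>j\<in>{1..<N}. f (j - 1) * g j)"
  for f :: "nat \<Rightarrow> 'a::semiring_0"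
  by (rule sum.reindex_bij_witness[of _ "\<lambda>j. j - 1" Suc]) auto

text \<open>Fixes the index layout: 0 for the constant 1, \<open>j\<close> for
  \<open>q_poly\<close>, \<open>N + j - 1\<close> for \<open>qbar_poly\<close>, and
  \<open>2 * N - 1\<close> for \<open>q_last\<close>.\<close>

lemma sum_q_family:
  assumes "N \<ge> 2"
  shows "(\<Sum>i<length (q_family N m a). c i * q_family N m a ! i) =
    c 0 + (\<Sum>j\<in>{1..<N}. c j * q_poly N m j (a j)) +
    (\<Sum>j\<in>{1..<N}. c (N + j - 1) * qbar_poly N m j (a j)) + c (2 * N - 1) * q_last N m"
proof -
  have 1: "Suc (length (map g [1..<N])) = N" for g :: "nat \<Rightarrow> bipoly" using assms by simp
  have "1 + (N - 1 + (N - 1)) = 2 * N - 1" "1 + (N - 1) = N" using assms by auto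
  moreover have "(\<Sum>j\<in>{1..<N}. c (Suc (j - Suc 0)) * g j) = (\<Sum>j\<in>{1..<N}. c j * g j)"
    "(\<Sum>j\<in>{1..<N}. c (Suc (N + j - Suc (Suc 0))) * g j) = (\<Sum>j\<in>{1..<N}. c (N + j - 1) * g j)"
    for g :: "nat \<Rightarrow> bipoly"
    using assms by (auto intro!: sum.cong arg_cong[of _ _ c] arg_cong2[of _ _ _ _ "(*)"])
  ultimately show ?thesis
    unfolding q_family_def sum_nth_append sum_nth_map_upt using assms
    by (simp add: add.assoc)
qed

lemma length_q_family: "N \<ge> 2 \<Longrightarrow> length (q_family N m a) = 2 * N"
  by (simp add: q_family_def)

text \<open>Modulo \<open>Zbar\<close> the conjugate generators disappear, and the residues isolate
  each coefficient of a \<open>q_poly\<close>; modulo \<open>Z\<close> the roles are exchanged. The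
  coefficients of 1 and of \<open>q_last\<close> share the residue 0 and need both
  reductions.\<close>

lemma relation_mod_zero:
  assumes N: "N \<ge> 2" and a: "\<forall>j\<in>{1..<N}. coeff_solution N m j (a j)"
    and c: "\<And>i. i < 2 * N \<Longrightarrow> c i \<in> invariants N"
    and rel: "(\<Sum>i<length (q_family N m a). c i * q_family N m a ! i) = 0"
    and i: "i < 2 * N"
  shows "mod_Zbar (c i) = 0"
proof -
  define f where "f i = mod_Zbar (c i)" for i
  have N0: "N > 0" using N by simp
  have f': "mod_Z (c i) = f i" if "i < 2 * N" for i
    using mod_Z_invariant[OF N0 c[OF that]] by (simp add: f_def)
  have supp: "supported_on_multiples N (f i)" if "i < 2 * N" for i
    unfolding f_def by (rule supported_mod_Zbar[OF N c[OF that]])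
  let ?M = "N * (2 * m + 1)"
  have nz: "a j 0 \<noteq> 0" if "j \<in> {1..<N}" for j
    using coeff_solution_0_nonzero[OF that] a that by blast
  note rel' = rel[unfolded sum_q_family[OF N]]
  have "mod_Zbar (c 0 + (\<Sum>j\<in>{1..<N}. c j * q_poly N m j (a j)) +
    (\<Sum>j\<in>{1..<N}. c (N + j - 1) * qbar_poly N m j (a j)) + c (2 * N - 1) * q_last N m) =
    (f 0 + monom 1 ?M * f (2 * N - 1)) + (\<Sum>j\<in>{1..<N}. monom (a j 0) (m * N + j) * f j)"
    unfolding mod_Zbar.add mod_Zbar.sum mod_Zbar.mult mod_q_last(1)[OF N0]
    by (simp add: mod_q_poly[OF N0] f_def mult.commute)
  then have 1: "(f 0 + monom 1 ?M * f (2 * N - 1)) + (\<Sum>j\<in>{1..<N}. monom (a j 0) (m * N + j) * f j) = 0"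
    unfolding rel' mod_Zbar.zero by (rule sym)
  have "mod_Z (c 0 + (\<Sum>j\<in>{1..<N}. c j * q_poly N m j (a j)) +
    (\<Sum>j\<in>{1..<N}. c (N + j - 1) * qbar_poly N m j (a j)) + c (2 * N - 1) * q_last N m) =
    (f 0 + monom (-1) ?M * f (2 * N - 1)) +
    (\<Sum>j\<in>{1..<N}. monom (cnj (a j 0)) (m * N + j) * mod_Z (c (N + j - 1)))"
    unfolding mod_Z.add mod_Z.sum mod_Z.mult mod_q_last(2)[OF N0] minus_monom
    using N by (simp add: mod_q_poly[OF N0] f' mult.commute)
  then have 2: "(f 0 + monom (-1) ?M * f (2 * N - 1)) +
    (\<Sum>j\<in>{1..<N}. monom (cnj (a j 0)) (m * N + j) * mod_Z (c (N + j - 1))) = 0"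
    unfolding rel' mod_Z.zero by (rule sym)
  have supp': "supported_on_multiples N (f 0 + monom x ?M * f (2 * N - 1))" for x
    using N by (intro supported_add supported_mult_monom supp) auto
  have e1: "f 0 + monom 1 ?M * f (2 * N - 1) = 0" and j1: "f j = 0" if "j \<in> {1..<N}" for j
    using residues_independent[where b = "\<lambda>j. a j 0" and f = f, OF supp' _ nz 1] supp that by auto
  have h: "supported_on_multiples N (mod_Z (c (N + j - 1)))" "cnj (a j 0) \<noteq> 0" if "j \<in> {1..<N}" for j
  proof -
    have "N + j - 1 < 2 * N" using that by auto
    then show "supported_on_multiples N (mod_Z (c (N + j - 1)))" "cnj (a j 0) \<noteq> 0"
      using supp[of "N + j - 1"] f'[of "N + j - 1"] nz[OF that] by simp_all
  qed
  have e2: "f 0 + monom (-1) ?M * f (2 * N - 1) = 0"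
    by (rule residues_independent(1)[where b = "\<lambda>j. cnj (a j 0)", OF supp' h 2])
  have j2: "f (N + j - 1) = 0" if "j \<in> {1..<N}" for j
  proof -
    have "mod_Z (c (N + j - 1)) = 0"
      by (rule residues_independent(2)[where b = "\<lambda>j. cnj (a j 0)", OF supp' h 2 that])
    moreover have "N + j - 1 < 2 * N" using that by auto
    ultimately show ?thesis using f' by metis
  qed
  \<comment> \<open>\<open>e1\<close> was derived under an assumption on an index \<open>j\<close>,
    so some index is supplied. As the sign of \<open>q_last\<close> differs in the two reductions,
    the sum and difference of \<open>e1\<close> and \<open>e2\<close> separate the two
    coefficients.\<close>
  have "1 \<in> {1..<N}" using N by simp
  from e1[OF this] e2 have "2 * f 0 = 0" "2 * (monom 1 ?M * f (2 * N - 1)) = 0"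
    by (simp_all add: minus_monom[symmetric] add_eq_0_iff)
  then have "f 0 = 0" "f (2 * N - 1) = 0" by simp_all
  moreover have "i = 0 \<or> i \<in> {1..<N} \<or> i + 1 - N \<in> {1..<N} \<and> N + (i + 1 - N) - 1 = i \<or> i = 2 * N - 1"
    using i by auto
  ultimately have "f i = 0" using j1[of i] j2[of "i + 1 - N"] by auto
  then show ?thesis by (simp add: f_def)
qed

text \<open>All coefficients of a relation are divisible by \<sigma>_1, and the quotients are
  invariants satisfying the same relation with a smaller common degree bound
  \<open>n\<close>.\<close>

lemma q_family_independent:
  assumes N: "N \<ge> 2" and a: "\<forall>j\<in>{1..<N}. coeff_solution N m j (a j)"
    and "\<And>i. i < 2 * N \<Longrightarrow> c i \<in> invariants N \<and> deg_below n (c i)"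
    and "(\<Sum>i<length (q_family N m a). c i * q_family N m a ! i) = 0"
    and "i < 2 * N"
  shows "c i = 0"
  using assms(3-)
proof (induction n arbitrary: c i)
  case 0
  then show ?case by (simp add: deg_below_def)
next
  case (Suc n)
  have "mod_Zbar (c i) = 0" if "i < 2 * N" for i
    using relation_mod_zero[OF N a _ Suc.prems(2) that] Suc.prems(1) by blast
  moreover from this have "mod_Z (c i) = 0" if "i < 2 * N" for i
    using mod_Z_invariant[of N "c i"] N Suc.prems(1) that by simp
  ultimately have "\<exists>q. deg_below n q \<and> c i = Z * Zbar * q" if "i < 2 * N" for i
    using divide_Z_Zbar[of n "c i"] Suc.prems(1) that by blast
  then obtain e where e: "\<And>i. i < 2 * N \<Longrightarrow> deg_below n (e i) \<and> c i = Z * Zbar * e i" by metis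
  have "e i \<in> invariants N" if "i < 2 * N" for i
    using invariants_cancel_norm[of "e i" N] e[OF that] Suc.prems(1)[OF that] by simp
  moreover have "(\<Sum>i<length (q_family N m a). e i * q_family N m a ! i) = 0"
  proof -
    have "Z * Zbar * (\<Sum>i<length (q_family N m a). e i * q_family N m a ! i) = 0"
      unfolding Suc.prems(2)[symmetric] sum_distrib_left
      by (intro sum.cong) (auto simp: e length_q_family[OF N] mult.assoc)
    then show ?thesis using Z_nonzero Zbar_nonzero by simp
  qed
  ultimately have "e i = 0" using Suc.IH[of e i] e Suc.prems(3) by blast
  then show ?case using e Suc.prems(3) by simp
qed

lemma is_basis_q_family:
  assumes N: "N \<ge> 2" and a: "\<forall>j\<in>{1..<N}. coeff_solution N m j (a j)"
  shows "is_basis (invariants N) (quasiinvariants N m) (q_family N m a)"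
  unfolding is_basis_def
proof (intro conjI ballI allI impI)
  show "set (q_family N m a) \<subseteq> quasiinvariants N m"
    using q_family_subset N a by simp
next
  fix q assume "q \<in> quasiinvariants N m"
  then show "\<exists>c. (\<forall>i<length (q_family N m a). c i \<in> invariants N) \<and>
      q = (\<Sum>i<length (q_family N m a). c i * q_family N m a ! i)"
    using quasiinvariants_in_span[OF N a] by (simp add: inv_span_def)
next
  fix c i
  assume c: "(\<forall>i<length (q_family N m a). c i \<in> invariants N) \<and>
      (\<Sum>i<length (q_family N m a). c i * q_family N m a ! i) = 0"
    and i: "i < length (q_family N m a)"
  have "\<forall>i. \<exists>d. deg_below d (c i)" using deg_below_exists by blast
  then obtain d where d: "\<And>i. deg_below (d i) (c i)" by metis
  \<comment> \<open>The sum of the individual bounds serves as a common one.\<close>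
  have "deg_below (\<Sum>i<2 * N. d i) (c i)" if "i < 2 * N" for i
    using that by (intro deg_below_mono[OF d] member_le_sum) auto
  then show "c i = 0"
    using q_family_independent[OF N a, of c "\<Sum>i<2 * N. d i" i] c i by (simp add: length_q_family[OF N])
qed

theorem theorem8:
  fixes N m :: nat
  assumes "N \<ge> 2"
  shows "is_subring (quasiinvariants N m) \<and> is_subring (invariants N) \<and>
    invariants N \<subseteq> quasiinvariants N m \<and>
    free_fin_gen (invariants N) (quasiinvariants N m) \<and>
    (\<exists>a. \<forall>j\<in>{1..<N}. coeff_solution N m j (a j)) \<and>
    (\<forall>a. (\<forall>j\<in>{1..<N}. coeff_solution N m j (a j)) \<longrightarrow>
         is_basis (invariants N) (quasiinvariants N m) (q_family N m a))"
proof -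
  \<comment> \<open>Freeness asks for an actual basis, so at least one choice of coefficients must
    exist.\<close>
  have a: "\<exists>a. \<forall>j\<in>{1..<N}. coeff_solution N m j (a j)"
    using coeff_solution_exists by (intro bchoice) blast
  then show ?thesis
    using is_basis_q_family[OF assms] is_subring_quasiinvariants is_subring_invariants
      invariants_subset_quasiinvariants unfolding free_fin_gen_def by metis
qed

end
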